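(* Let $\lambda_0\in(0,\pi)$, $d_+,d_-\in(0,1/2)$ with $d_+\neq d_-$, and $q_{1,+},q_{1,-}\in\mathbb{R}\setminus\{0\}$. Set $$q_{0,+}=\frac{\sin(\pi d_+)}{1+\cos(\pi d_+)}q_{1,+},\qquad q_{0,-}=-\frac{\sin(\pi d_-)}{1+\cos(\pi d_-)}q_{1,-}.$$ Let $\{X_n^+\}_{n\in\mathbb{Z}}$ be the FRMod$(0,d,0)$ series with cyclical frequency $\lambda_0$ and parameters $(d,q_0,q_1)=(d_+,q_{0,+},q_{1,+})$, let $\{X_n^-\}_{n\in\mathbb{Z}}$ be the FRMod$(0,d,0)$ series with cyclical frequency $\lambda_0$ and parameters $(d,q_0,q_1)=(d_-,q_{0,-},q_{1,-})$, and suppose $X^+$ and $X^-$ are uncorrelated. Then the spectral density $f_X$ of $X_n=X_n^++X_n^-$ satisfies $$f_X(\lambda)\sim\begin{cases}c_{f,+}(\lambda-\lambda_0)^{-2d_+},&\lambda\to\lambda_0^+,\\c_{f,-}(\lambda_0-\lambda)^{-2d_-},&\lambda\to\lambda_0^-,\end{cases}$$ with $$c_{f,+}=\frac{q_{1,+}^2(1-\cos(2\pi d_+))}{\pi(1+\cos(\pi d_+))},\qquad c_{f,-}=\frac{q_{1,-}^2(1-\cos(2\pi d_-))}{\pi(1+\cos(\pi d_-))}.$$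
   Context: FRMod$(0,d,0)$ series with cyclical frequency $\lambda_0$ and parameters $d\in(0,1/2)$, $q_0,q_1\in\mathbb{R}$: $X_n=\cos(\lambda_0n)Y_{1,n}+\sin(\lambda_0n)Y_{2,n}$, where $Y_n=(Y_{1,n},Y_{2,n})^T=\sum_{k\ge0}c_{d,k}Q_+\varepsilon_{n-k}+\sum_{k\ge0}c_{d,k}Q_-\varepsilon_{n+k}$ (mean-square convergence), $c_{d,k}=\frac{\Gamma(k+d)}{\Gamma(k+1)\Gamma(d)}$, $Q_+=\begin{pmatrix}q_0&q_1\\-q_1&q_0\end{pmatrix}=Q_-^T$, and $\{\varepsilon_n\}$ is a bivariate white noise ($\mathbb{E}\varepsilon_n=0$, $\mathbb{E}\varepsilon_n\varepsilon_m^T=0$ for $n\ne m$, $\mathbb{E}\varepsilon_n\varepsilon_n^T=I_2$). Such a series is second-order stationary. The spectral density convention is $f_X(\lambda)=\frac1{2\pi}\sum_{h}e^{-ih\lambda}\gamma_X(h)$, $\gamma_X(h)=\int_{-\pi}^\pi e^{ih\lambda}f_X(\lambda)d\lambda$. Here $\sim$ means that the ratio of the two sides tends to $1$. *)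

theory Defs
  imports "HOL-Probability.Probability"
begin

definition square_integrable ::
  "'w measure \<Rightarrow> ('w \<Rightarrow> 'b::{banach, second_countable_topology}) \<Rightarrow> bool" where
  "square_integrable M U \<longleftrightarrow>
     U \<in> borel_measurable M \<and> integrable M (\<lambda>w. (norm (U w))\<^sup>2)"

definition covariance :: "'w measure \<Rightarrow> ('w \<Rightarrow> real) \<Rightarrow> ('w \<Rightarrow> real) \<Rightarrow> real" where
  "covariance M U V =
     (LINT w|M. (U w - (LINT v|M. U v)) * (V w - (LINT v|M. V v)))"

definition uncorrelated_series ::
  "'w measure \<Rightarrow> (int \<Rightarrow> 'w \<Rightarrow> real) \<Rightarrow> (int \<Rightarrow> 'w \<Rightarrow> real) \<Rightarrow> bool" where
  "uncorrelated_series M U V \<longleftrightarrow> (\<forall>n m. covariance M (U n) (V m) = 0)"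

definition second_order_stationary :: "'w measure \<Rightarrow> (int \<Rightarrow> 'w \<Rightarrow> real) \<Rightarrow> bool" where
  "second_order_stationary M X \<longleftrightarrow>
     (\<forall>n. square_integrable M (X n)) \<and>
     (\<forall>n m. (LINT w|M. X n w) = (LINT w|M. X m w)) \<and>
     (\<forall>n m h. covariance M (X (n + h)) (X n) = covariance M (X (m + h)) (X m))"

text \<open>Only meaningful for second-order stationary series.\<close>

definition autocovariance :: "'w measure \<Rightarrow> (int \<Rightarrow> 'w \<Rightarrow> real) \<Rightarrow> int \<Rightarrow> real" where
  "autocovariance M X h = covariance M (X h) (X 0)"

definition bivariate_white_noise :: "'w measure \<Rightarrow> (int \<Rightarrow> 'w \<Rightarrow> real^2) \<Rightarrow> bool" where
  "bivariate_white_noise M e \<longleftrightarrow>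
     (\<forall>n. square_integrable M (e n)) \<and>
     (\<forall>n. (LINT w|M. e n w) = 0) \<and>
     (\<forall>n m. (\<chi> i j. LINT w|M. e n w $ i * e m w $ j) = (if n = m then mat 1 else 0))"

definition mean_square_sums ::
  "'w measure \<Rightarrow> (nat \<Rightarrow> 'w \<Rightarrow> real^2) \<Rightarrow> ('w \<Rightarrow> real^2) \<Rightarrow> bool" where
  "mean_square_sums M u S \<longleftrightarrow>
     (\<forall>k. square_integrable M (u k)) \<and> square_integrable M S \<and>
     (\<lambda>N. LINT w|M. (norm ((\<Sum>k<N. u k w) - S w))\<^sup>2) \<longlonglongrightarrow> 0"

definition frac_coeff :: "real \<Rightarrow> nat \<Rightarrow> real" where
  "frac_coeff d k = Gamma (real k + d) / (Gamma (real k + 1) * Gamma d)"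

definition Q_plus :: "real \<Rightarrow> real \<Rightarrow> real^2^2" where
  "Q_plus q0 q1 = vector [vector [q0, q1], vector [- q1, q0]]"

definition Q_minus :: "real \<Rightarrow> real \<Rightarrow> real^2^2" where
  "Q_minus q0 q1 = transpose (Q_plus q0 q1)"

text \<open>
  \<open>A n\<close> is the causal and \<open>B n\<close> the anticausal series. They are versions of mean-square limits,
  hence determined only up to null sets, and so is \<open>X\<close>.
\<close>

definition FRMod0d0 ::
  "'w measure \<Rightarrow> real \<Rightarrow> real \<Rightarrow> real \<Rightarrow> real \<Rightarrow> (int \<Rightarrow> 'w \<Rightarrow> real) \<Rightarrow> bool" where
  "FRMod0d0 M l0 d q0 q1 X \<longleftrightarrow>
     (\<exists>(e :: int \<Rightarrow> 'w \<Rightarrow> real^2) A B Y.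
        bivariate_white_noise M e \<and>
        (\<forall>n. mean_square_sums M
               (\<lambda>k w. frac_coeff d k *\<^sub>R (Q_plus q0 q1 *v e (n - int k) w)) (A n)) \<and>
        (\<forall>n. mean_square_sums M
               (\<lambda>k w. frac_coeff d k *\<^sub>R (Q_minus q0 q1 *v e (n + int k) w)) (B n)) \<and>
        (\<forall>n w. Y n w = A n w + B n w) \<and>
        (\<forall>n w. X n w = cos (l0 * of_int n) * Y n w $ 1 + sin (l0 * of_int n) * Y n w $ 2))"

text \<open>
  For long-memory series the autocovariances are not absolutely summable; the two-sided Fourier
  series is therefore read as the limit of its symmetric partial sums. These are real, since the
  autocovariance of a real series is even, so taking the real part loses nothing.
\<close>

definition spectral_partial_sum :: "(int \<Rightarrow> real) \<Rightarrow> real \<Rightarrow> nat \<Rightarrow> complex" where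
  "spectral_partial_sum \<gamma> l N =
     (\<Sum>h\<in>{- int N..int N}. cis (- (of_int h * l)) * complex_of_real (\<gamma> h))"

definition spectral_density :: "(int \<Rightarrow> real) \<Rightarrow> real \<Rightarrow> real" where
  "spectral_density \<gamma> l = Re (lim (spectral_partial_sum \<gamma> l)) / (2 * pi)"

text \<open>
  Where the partial sums diverge (as at the singularity of a long-memory density),
  \<open>spectral_density\<close> takes an unspecified value. The next predicate says that the series
  does define a density.
\<close>

definition has_spectral_density :: "(int \<Rightarrow> real) \<Rightarrow> bool" where
  "has_spectral_density \<gamma> \<longleftrightarrow>
     (AE l in lborel. l \<in> {-pi..pi} \<longrightarrow> convergent (spectral_partial_sum \<gamma> l)) \<and>
     set_integrable lborel {-pi..pi} (spectral_density \<gamma>) \<and>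
     (\<forall>h. complex_of_real (\<gamma> h) =
        (LINT l:{-pi..pi}|lborel.
           cis (of_int h * l) * complex_of_real (spectral_density \<gamma> l)))"

end

theory Submission
  imports Defs "HOL-Real_Asymp.Real_Asymp"
begin

text \<open>
  Write \<open>c k\<close> for the coefficients of \<open>(1 - z) powr (- d)\<close> and \<open>G\<close> for the real part of
  \<open>(q0 + i q1) (1 - cis \<theta>) powr (- d)\<close>. Truncating the two moving averages at \<open>N\<close> gives a series whose
  autocovariances are exactly the Fourier coefficients of \<open>(2 G_N(l0 + l)\<^sup>2 + 2 G_N(l0 - l)\<^sup>2) / (2 pi)\<close>,
  where \<open>G_N\<close> is the partial sum of \<open>G\<close>. Since \<open>c\<close> is square summable, both sides converge as
  \<open>N\<close> tends to infinity, so \<open>G\<close> yields a density with the right Fourier coefficients. That the symmetric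
  partial sums of the Fourier series converge to it pointwise needs a separate argument: the
  autocorrelations of \<open>c\<close>, truncated or not, decrease in the lag, so summation by parts bounds
  the tails uniformly in \<open>N\<close>; the self-convolution of \<open>c\<close> is again such a coefficient sequence, with
  \<open>2 d\<close> in place of \<open>d\<close>. Finally \<open>1 - cis \<theta>\<close> has modulus \<open>2 sin (\<theta> / 2)\<close> and argument
  \<open>(\<theta> - pi) / 2\<close>, and the choice of \<open>q0\<close> makes the leading coefficient of \<open>G\<close> vanish on one side of
  the origin, so near \<open>l0\<close> each component is singular on one side and bounded on the other.
\<close>

section \<open>Mean-square convergence\<close>

lemma square_integrable_mult_integrable:
  fixes U V :: "'a \<Rightarrow> real"
  assumes "square_integrable M U" "square_integrable M V"
  shows "integrable M (\<lambda>x. U x * V x)"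
proof (rule Bochner_Integration.integrable_bound)
  show "integrable M (\<lambda>x. (U x)\<^sup>2 + (V x)\<^sup>2)"
    using assms by (auto simp: square_integrable_def)
  show "(\<lambda>x. U x * V x) \<in> borel_measurable M"
    using assms by (auto simp: square_integrable_def)
  have "\<bar>U x * V x\<bar> \<le> (U x)\<^sup>2 + (V x)\<^sup>2" for x
  proof -
    have "2 * (\<bar>U x\<bar> * \<bar>V x\<bar>) \<le> (U x)\<^sup>2 + (V x)\<^sup>2"
      using sum_squares_bound[of "\<bar>U x\<bar>" "\<bar>V x\<bar>"] by (simp add: mult.assoc)
    moreover have "0 \<le> \<bar>U x\<bar> * \<bar>V x\<bar>" by simp
    ultimately show ?thesis unfolding abs_mult by linarith
  qed
  then show "AE x in M. norm (U x * V x) \<le> norm ((U x)\<^sup>2 + (V x)\<^sup>2)"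
    by simp
qed

lemma square_integrable_add:
  assumes "square_integrable M U" "square_integrable M V"
  shows "square_integrable M (\<lambda>x. U x + V x)"
  unfolding square_integrable_def
proof
  show m: "(\<lambda>x. U x + V x) \<in> borel_measurable M"
    using assms by (auto simp: square_integrable_def)
  show "integrable M (\<lambda>x. (norm (U x + V x))\<^sup>2)"
  proof (rule Bochner_Integration.integrable_bound)
    show "integrable M (\<lambda>x. 2 * (norm (U x))\<^sup>2 + 2 * (norm (V x))\<^sup>2)"
      using assms by (auto simp: square_integrable_def)
    have "(norm (U x + V x))\<^sup>2 \<le> 2 * (norm (U x))\<^sup>2 + 2 * (norm (V x))\<^sup>2" for x
    proof -
      have "(norm (U x + V x))\<^sup>2 \<le> (norm (U x) + norm (V x))\<^sup>2"
        by (intro power_mono norm_triangle_ineq) auto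
      also have "\<dots> \<le> 2 * (norm (U x))\<^sup>2 + 2 * (norm (V x))\<^sup>2"
        using sum_squares_bound[of "norm (U x)" "norm (V x)"] by (simp add: power2_sum)
      finally show ?thesis .
    qed
    then show "AE x in M. norm ((norm (U x + V x))\<^sup>2) \<le> norm (2 * (norm (U x))\<^sup>2 + 2 * (norm (V x))\<^sup>2)"
      by simp
  qed (use m in measurable)
qed

lemma square_integrable_scaleR:
  "square_integrable M U \<Longrightarrow> square_integrable M (\<lambda>x. c *\<^sub>R U x)"
  by (auto simp: square_integrable_def power_mult_distrib)

lemma square_integrable_diff:
  assumes "square_integrable M U" "square_integrable M V"
  shows "square_integrable M (\<lambda>x. U x - V x)"
  using square_integrable_add[OF assms(1) square_integrable_scaleR[OF assms(2), of "-1"]] by simp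

lemma square_integrable_sum:
  assumes "\<And>i. i \<in> I \<Longrightarrow> square_integrable M (U i)"
  shows "square_integrable M (\<lambda>x. \<Sum>i\<in>I. U i x)"
  using assms
proof (induction I rule: infinite_finite_induct)
  case (insert i I)
  then show ?case using square_integrable_add[of M "U i"] by simp
qed (auto simp: square_integrable_def)

lemma square_integrable_inner:
  fixes U :: "'a \<Rightarrow> 'b::euclidean_space"
  assumes "square_integrable M U"
  shows "square_integrable M (\<lambda>x. v \<bullet> U x)"
  unfolding square_integrable_def
proof
  show m: "(\<lambda>x. v \<bullet> U x) \<in> borel_measurable M"
    using assms by (auto simp: square_integrable_def)
  show "integrable M (\<lambda>x. (norm (v \<bullet> U x))\<^sup>2)"
  proof (rule Bochner_Integration.integrable_bound)
    show "integrable M (\<lambda>x. (norm v)\<^sup>2 * (norm (U x))\<^sup>2)"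
      using assms by (auto simp: square_integrable_def)
    have "(norm (v \<bullet> U x))\<^sup>2 \<le> (norm v)\<^sup>2 * (norm (U x))\<^sup>2" for x
      unfolding power_mult_distrib[symmetric] by (intro power_mono) (auto simp: Cauchy_Schwarz_ineq2)
    then show "AE x in M. norm ((norm (v \<bullet> U x))\<^sup>2) \<le> norm ((norm v)\<^sup>2 * (norm (U x))\<^sup>2)"
      by simp
  qed (use m in measurable)
qed

lemma (in finite_measure) square_integrable_imp_integrable_norm:
  assumes "square_integrable M U"
  shows "integrable M U"
proof (rule Bochner_Integration.integrable_bound)
  show "integrable M (\<lambda>x. 1 + (norm (U x))\<^sup>2)"
    using assms by (auto simp: square_integrable_def)
  show "U \<in> borel_measurable M" using assms by (simp add: square_integrable_def)
  have "norm (U x) \<le> 1 + (norm (U x))\<^sup>2" for x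
    using sum_squares_bound[of "norm (U x)" 1] by (smt (verit) mult_1_right norm_ge_zero one_power2)
  then show "AE x in M. norm (U x) \<le> norm (1 + (norm (U x))\<^sup>2)"
    by simp
qed

text \<open>Cauchy-Schwarz by the discriminant argument: the integral of the square of
  \<open>U + t * V\<close> is a quadratic in \<open>t\<close> that is nowhere negative.\<close>

lemma abs_integral_mult_le:
  fixes U V :: "'a \<Rightarrow> real"
  assumes "square_integrable M U" "square_integrable M V"
  shows "\<bar>LINT x|M. U x * V x\<bar> \<le> sqrt (LINT x|M. (U x)\<^sup>2) * sqrt (LINT x|M. (V x)\<^sup>2)"
proof -
  define a where "a = (LINT x|M. (U x)\<^sup>2)"
  define b where "b = (LINT x|M. U x * V x)"
  define c where "c = (LINT x|M. (V x)\<^sup>2)"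
  have i: "integrable M (\<lambda>x. (U x)\<^sup>2)" "integrable M (\<lambda>x. (V x)\<^sup>2)" "integrable M (\<lambda>x. U x * V x)"
    using assms square_integrable_mult_integrable[OF assms] by (auto simp: square_integrable_def)
  have q: "0 \<le> a + 2 * t * b + t\<^sup>2 * c" for t
  proof -
    have "0 \<le> (LINT x|M. (U x + t * V x)\<^sup>2)" by simp
    also have "\<dots> = (LINT x|M. (U x)\<^sup>2 + 2 * t * (U x * V x) + t\<^sup>2 * (V x)\<^sup>2)"
      by (intro Bochner_Integration.integral_cong) (auto simp: power2_eq_square algebra_simps)
    also have "\<dots> = a + 2 * t * b + t\<^sup>2 * c"
      using i by (simp add: a_def b_def c_def)
    finally show ?thesis .
  qed
  have a0: "0 \<le> a" and c0: "0 \<le> c" by (auto simp: a_def c_def)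
  have "b\<^sup>2 \<le> a * c"
  proof (cases "c = 0")
    case True
    have "b = 0"
    proof (rule ccontr)
      assume "b \<noteq> 0"
      \<comment> \<open>With \<open>c = 0\<close> the quadratic is affine in \<open>t\<close>, and
        this \<open>t\<close> gives it the value -1.\<close>
      with q[of "- (a + 1) / (2 * b)"] True show False by (simp add: field_simps)
    qed
    then show ?thesis using True by simp
  next
    case False
    with c0 have "c > 0" by simp
    \<comment> \<open>The minimum of the quadratic, attained at \<open>t = - b / c\<close>.\<close>
    have "0 \<le> a - b\<^sup>2 / c"
      using q[of "- b / c"] \<open>c > 0\<close> by (simp add: power2_eq_square field_simps)
    then show ?thesis using \<open>c > 0\<close> by (simp add: field_simps)
  qed
  then have "sqrt (b\<^sup>2) \<le> sqrt (a * c)" by (rule real_sqrt_le_mono)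
  then have "\<bar>b\<bar> \<le> sqrt a * sqrt c" by (simp only: real_sqrt_mult real_sqrt_abs)
  then show ?thesis unfolding a_def b_def c_def .
qed

text \<open>Expanding around the limits leaves three error terms, each with a factor that is small
  in mean square; Cauchy-Schwarz bounds them by \<open>D\<close>. The lemma serves random variables
  and, later, functions of the frequency.\<close>

lemma L2_tendsto_integral_mult:
  fixes U V :: "nat \<Rightarrow> 'a \<Rightarrow> real"
  assumes U: "\<And>n. square_integrable M (U n)" "square_integrable M u"
      "(\<lambda>n. LINT x|M. (U n x - u x)\<^sup>2) \<longlonglongrightarrow> 0"
    and V: "\<And>n. square_integrable M (V n)" "square_integrable M v"
      "(\<lambda>n. LINT x|M. (V n x - v x)\<^sup>2) \<longlonglongrightarrow> 0"
  shows "(\<lambda>n. LINT x|M. U n x * V n x) \<longlonglongrightarrow> (LINT x|M. u x * v x)"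
proof -
  let ?N = "\<lambda>f. sqrt (LINT x|M. (f x)\<^sup>2)"
  define D where "D n = ?N (\<lambda>x. U n x - u x) * ?N (\<lambda>x. V n x - v x) + ?N u * ?N (\<lambda>x. V n x - v x)
       + ?N (\<lambda>x. U n x - u x) * ?N v" for n
  have D: "D \<longlonglongrightarrow> sqrt 0 * sqrt 0 + ?N u * sqrt 0 + sqrt 0 * ?N v"
    unfolding D_def by (intro tendsto_intros U V)
  have "norm ((LINT x|M. U n x * V n x) - (LINT x|M. u x * v x)) \<le> D n" for n
  proof -
    note d = square_integrable_diff[OF U(1)[of n] U(2)] square_integrable_diff[OF V(1)[of n] V(2)]
    note i = square_integrable_mult_integrable[OF d]
      square_integrable_mult_integrable[OF U(2) d(2)] square_integrable_mult_integrable[OF d(1) V(2)]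
      square_integrable_mult_integrable[OF U(1)[of n] V(1)[of n]]
      square_integrable_mult_integrable[OF U(2) V(2)]
    have "(LINT x|M. U n x * V n x) - (LINT x|M. u x * v x) = (LINT x|M. U n x * V n x - u x * v x)"
      using i by simp
    also have "\<dots> = (LINT x|M. (U n x - u x) * (V n x - v x) + u x * (V n x - v x) + (U n x - u x) * v x)"
      by (intro Bochner_Integration.integral_cong) (auto simp: algebra_simps)
    also have "\<dots> = (LINT x|M. (U n x - u x) * (V n x - v x)) + (LINT x|M. u x * (V n x - v x))
       + (LINT x|M. (U n x - u x) * v x)"
      using i(1-3) by (simp only: Bochner_Integration.integral_add Bochner_Integration.integrable_add)
    finally show ?thesis
      using abs_integral_mult_le[OF d] abs_integral_mult_le[OF U(2) d(2)]
        abs_integral_mult_le[OF d(1) V(2)]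
      unfolding D_def real_norm_def by linarith
  qed
  moreover have "D \<longlonglongrightarrow> 0" using D by simp
  ultimately have "(\<lambda>n. (LINT x|M. U n x * V n x) - (LINT x|M. u x * v x)) \<longlonglongrightarrow> 0"
    by (rule Lim_null_comparison[OF always_eventually[OF allI]])
  then show ?thesis by (rule LIM_zero_cancel)
qed

text \<open>The limit is already known pointwise; Fatou's lemma turns the Cauchy property into
  mean-square convergence to this particular function.\<close>

lemma L2_Cauchy_pointwise_limit:
  fixes U :: "nat \<Rightarrow> 'a \<Rightarrow> real"
  assumes U: "\<And>n. square_integrable M (U n)" and u: "u \<in> borel_measurable M"
    and lim: "AE x in M. (\<lambda>n. U n x) \<longlonglongrightarrow> u x"
    and Cauchy: "\<And>e. e > 0 \<Longrightarrow> \<exists>N. \<forall>m\<ge>N. \<forall>n\<ge>N. (LINT x|M. (U m x - U n x)\<^sup>2) \<le> e"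
  shows "square_integrable M u" "(\<lambda>n. LINT x|M. (U n x - u x)\<^sup>2) \<longlonglongrightarrow> 0"
proof -
  have Um [measurable]: "\<And>n. U n \<in> borel_measurable M" using U by (auto simp: square_integrable_def)
  note u [measurable]
  have bd: "(\<integral>\<^sup>+x. ennreal ((U n x - u x)\<^sup>2) \<partial>M) \<le> ennreal e"
    if N: "\<forall>m\<ge>N. \<forall>n\<ge>N. (LINT x|M. (U m x - U n x)\<^sup>2) \<le> e" and n: "n \<ge> N" for N n e
  proof -
    \<comment> \<open>Fatou is applied along \<open>m\<close> with \<open>n\<close> fixed. The
      integral is taken in \<open>ennreal\<close> because \<open>u\<close> is not yet known to be
      square integrable.\<close>
    have "(\<integral>\<^sup>+x. ennreal ((U n x - u x)\<^sup>2) \<partial>M) = (\<integral>\<^sup>+x. liminf (\<lambda>m. ennreal ((U n x - U m x)\<^sup>2)) \<partial>M)"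
    proof (intro nn_integral_cong_AE, use lim in eventually_elim)
      case (elim x)
      have "(\<lambda>m. ennreal ((U n x - U m x)\<^sup>2)) \<longlonglongrightarrow> ennreal ((U n x - u x)\<^sup>2)"
        by (intro tendsto_intros elim)
      then show ?case by (intro lim_imp_Liminf[symmetric]) auto
    qed
    also have "\<dots> \<le> liminf (\<lambda>m. \<integral>\<^sup>+x. ennreal ((U n x - U m x)\<^sup>2) \<partial>M)"
      by (intro nn_integral_liminf) auto
    also have "\<dots> \<le> liminf (\<lambda>m. ennreal e)"
    proof (intro Liminf_mono eventually_sequentiallyI[of N])
      fix m assume "N \<le> m"
      have "integrable M (\<lambda>x. (U n x - U m x)\<^sup>2)"
        using square_integrable_diff[OF U U] by (simp add: square_integrable_def)
      then have "(\<integral>\<^sup>+x. ennreal ((U n x - U m x)\<^sup>2) \<partial>M) = ennreal (LINT x|M. (U n x - U m x)\<^sup>2)"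
        by (intro nn_integral_eq_integral) auto
      also have "\<dots> \<le> ennreal e" using N n \<open>N \<le> m\<close> by (intro ennreal_leI) auto
      finally show "(\<integral>\<^sup>+x. ennreal ((U n x - U m x)\<^sup>2) \<partial>M) \<le> ennreal e" .
    qed
    also have "\<dots> = ennreal e" by (intro lim_imp_Liminf) auto
    finally show ?thesis .
  qed
  obtain N1 where N1: "\<forall>m\<ge>N1. \<forall>n\<ge>N1. (LINT x|M. (U m x - U n x)\<^sup>2) \<le> 1"
    using Cauchy[of 1] by auto
  have "integrable M (\<lambda>x. (U N1 x - u x)\<^sup>2)"
    using bd[OF N1, of N1] by (intro integrableI_bounded) (auto intro: order.strict_trans1)
  then have "square_integrable M (\<lambda>x. U N1 x - u x)" by (auto simp: square_integrable_def)
  \<comment> \<open>\<open>u\<close> is recovered as \<open>U N1 - (U N1 - u)\<close>.\<close>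
  from square_integrable_diff[OF U[of N1] this]
  show su: "square_integrable M u" by simp
  show "(\<lambda>n. LINT x|M. (U n x - u x)\<^sup>2) \<longlonglongrightarrow> 0"
  proof (rule LIMSEQ_I)
    fix r :: real assume "r > 0"
    obtain N where N: "\<forall>m\<ge>N. \<forall>n\<ge>N. (LINT x|M. (U m x - U n x)\<^sup>2) \<le> r / 2"
      using Cauchy[of "r/2"] \<open>r > 0\<close> by auto
    show "\<exists>N. \<forall>n\<ge>N. norm ((LINT x|M. (U n x - u x)\<^sup>2) - 0) < r"
    proof (intro exI[of _ N] allI impI)
      fix n assume n: "n \<ge> N"
      have "integrable M (\<lambda>x. (U n x - u x)\<^sup>2)"
        using square_integrable_diff[OF U su] by (simp add: square_integrable_def)
      then have "(\<integral>\<^sup>+x. ennreal ((U n x - u x)\<^sup>2) \<partial>M) = ennreal (LINT x|M. (U n x - u x)\<^sup>2)"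
        by (intro nn_integral_eq_integral) auto
      with bd[OF N n] have "(LINT x|M. (U n x - u x)\<^sup>2) \<le> r / 2"
        using \<open>r > 0\<close> by (simp add: ennreal_le_iff)
      then show "norm ((LINT x|M. (U n x - u x)\<^sup>2) - 0) < r" using \<open>r > 0\<close> by simp
    qed
  qed
qed

section \<open>The binomial series on the unit circle\<close>

text \<open>Summation by parts: multiplying by \<open>1 - z\<close> turns the sum into differences
  of \<open>b\<close>, and these telescope in modulus because \<open>b\<close> decreases. The bound
  involves only the first coefficient, so it is uniform in the upper limit; both later tail
  estimates rely on this.\<close>

lemma norm_decseq_power_sum_le:
  fixes b :: "nat \<Rightarrow> real" and z :: "'a::{real_normed_field}"
  assumes dec: "decseq b" and nonneg: "\<And>n. 0 \<le> b n" and z: "norm z \<le> 1" "z \<noteq> 1" and mn: "m \<le> n"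
  shows "norm (\<Sum>h=m..<n. of_real (b h) * z ^ h) \<le> 2 * b m / norm (1 - z)"
proof -
  let ?S = "\<lambda>n. \<Sum>h=m..<n. of_real (b h) * z ^ h"
  have p: "norm (z ^ k) \<le> 1" for k
    using z by (simp add: norm_power power_le_one)
  \<comment> \<open>Keeping the boundary term on the left means that an induction step adds only
    \<open>(b (Suc n) - b n) * z ^ Suc n\<close>, of norm at most
    \<open>b n - b (Suc n)\<close>.\<close>
  have "norm ((1 - z) * ?S n + of_real (b n) * z ^ n) \<le> 2 * b m - b n"
    using mn
  proof (induction n rule: dec_induct)
    case base
    show ?case using mult_left_mono[OF p[of m] nonneg[of m]] nonneg[of m] by (simp add: norm_mult)
  next
    case (step n)
    have "(1 - z) * ?S (Suc n) + of_real (b (Suc n)) * z ^ Suc n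
        = ((1 - z) * ?S n + of_real (b n) * z ^ n) + of_real (b (Suc n) - b n) * z ^ Suc n"
      using step by (simp add: algebra_simps)
    also have "norm \<dots> \<le> (2 * b m - b n) + (b n - b (Suc n)) * 1"
    proof (intro norm_triangle_mono step.IH)
      have "norm (of_real (b (Suc n) - b n) * z ^ Suc n) = (b n - b (Suc n)) * norm (z ^ Suc n)"
        using decseq_SucD[OF dec, of n] by (simp only: norm_mult norm_of_real abs_of_nonpos) simp
      also have "\<dots> \<le> (b n - b (Suc n)) * 1"
        by (intro mult_left_mono p) (use decseq_SucD[OF dec, of n] in auto)
      finally show "norm (of_real (b (Suc n) - b n) * z ^ Suc n) \<le> (b n - b (Suc n)) * 1" .
    qed
    finally show ?case by simp
  qed
  moreover have "norm (of_real (b n) * z ^ n) \<le> b n"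
    using mult_left_mono[OF p[of n] nonneg[of n]] nonneg[of n] by (simp add: norm_mult)
  ultimately have "norm ((1 - z) * ?S n) \<le> 2 * b m"
    using norm_triangle_ineq4[of "(1 - z) * ?S n + of_real (b n) * z ^ n" "of_real (b n) * z ^ n"]
    by simp
  then show ?thesis
    using z by (simp add: norm_mult pos_le_divide_eq mult.commute)
qed

section \<open>Monotonicity, self-convolution and growth of the fractional coefficients\<close>

lemma frac_coeff_eq_pochhammer:
  assumes "0 < d"
  shows "frac_coeff d k = pochhammer d k / fact k"
proof -
  have "d \<notin> \<int>\<^sub>\<le>\<^sub>0" using assms by (auto elim!: nonpos_Ints_cases)
  then show ?thesis
    using Gamma_fact[of k, where 'a = real]
    by (simp add: frac_coeff_def pochhammer_Gamma add.commute field_simps)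
qed

lemma frac_coeff_pos: "0 < d \<Longrightarrow> 0 < frac_coeff d k"
  by (simp add: frac_coeff_eq_pochhammer pochhammer_pos)

lemma decseq_frac_coeff:
  assumes "0 < d" "d \<le> 1"
  shows "decseq (frac_coeff d)"
proof (rule decseq_SucI)
  fix n
  have "frac_coeff d (Suc n) = frac_coeff d n * ((d + n) / (1 + n))"
    using assms by (simp add: frac_coeff_eq_pochhammer pochhammer_Suc)
  also have "\<dots> \<le> frac_coeff d n * 1"
    using assms frac_coeff_pos[of d n] by (intro mult_left_mono) (auto simp: field_simps)
  finally show "frac_coeff d (Suc n) \<le> frac_coeff d n" by simp
qed

text \<open>This compares coefficients in the identity that the square of
  \<open>(1 - z) powr (- d)\<close> is \<open>(1 - z) powr (- 2 * d)\<close>. Formally it is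
  Vandermonde's identity for rising factorials.\<close>

lemma frac_coeff_convolution:
  assumes "0 < d"
  shows "(\<Sum>k\<le>n. frac_coeff d k * frac_coeff d (n - k)) = frac_coeff (2 * d) n"
proof -
  have "(\<Sum>k\<le>n. frac_coeff d k * frac_coeff d (n - k))
      = (\<Sum>k\<le>n. of_nat (n choose k) * pochhammer d k * pochhammer d (n - k)) / fact n"
    using assms
    by (auto simp: sum_divide_distrib frac_coeff_eq_pochhammer binomial_fact intro!: sum.cong)
  also have "\<dots> = frac_coeff (2 * d) n"
    using assms pochhammer_binomial_sum[of d d n] by (simp add: frac_coeff_eq_pochhammer)
  finally show ?thesis .
qed

text \<open>Euler's limit for the reciprocal Gamma function controls the growth:
  \<open>rGamma_series d\<close> converges, so the coefficients behave like a constant times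
  \<open>n powr (d - 1)\<close>. The formula fails at \<open>n = 0\<close>, where
  \<open>0 powr d\<close> is 0.\<close>

lemma frac_coeff_Suc_eq_rGamma_series:
  assumes "0 < d"
  shows "eventually (\<lambda>n. frac_coeff d (Suc n) = rGamma_series d n * (real n powr d / (real n + 1))) sequentially"
  using eventually_gt_at_top[of 0]
proof eventually_elim
  case (elim n)
  then show ?case
    using assms
    by (simp add: frac_coeff_eq_pochhammer rGamma_series_def powr_def add.commute mult.commute
        del: pochhammer_Suc distrib_left distrib_right)
qed

lemma frac_coeff_tendsto_0:
  assumes "0 < d" "d < 1"
  shows "frac_coeff d \<longlonglongrightarrow> 0"
proof -
  have "(\<lambda>n::nat. real n powr d / (real n + 1)) \<longlonglongrightarrow> 0"
    using assms by real_asymp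
  from tendsto_mult[OF rGamma_series_LIMSEQ[of d] this]
  have "(\<lambda>n. frac_coeff d (Suc n)) \<longlonglongrightarrow> 0"
    by (subst tendsto_cong[OF frac_coeff_Suc_eq_rGamma_series]) (use assms in auto)
  then show ?thesis by (simp add: filterlim_sequentially_Suc)
qed

text \<open>With \<open>B\<close> bounding the convergent \<open>rGamma_series d\<close>, the
  squares are at most a constant times \<open>n powr (2 * d - 2)\<close>, and \<open>d < 1/2\<close>
  puts this exponent below -1.\<close>

lemma summable_frac_coeff_square:
  assumes "0 < d" "d < 1/2"
  shows "summable (\<lambda>k. (frac_coeff d k)\<^sup>2)"
proof -
  obtain B where B: "\<And>n. norm (rGamma_series d n) \<le> B"
    using convergent_imp_Bseq[OF convergentI[OF rGamma_series_LIMSEQ[of d]]] by (auto simp: Bseq_def)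
  have "summable (\<lambda>n. (frac_coeff d (Suc n))\<^sup>2)"
  proof (rule summable_comparison_test_ev)
    show "summable (\<lambda>n. B\<^sup>2 * real n powr (2 * d - 2))"
      using assms by (intro summable_mult) (simp add: summable_real_powr_iff)
    show "eventually (\<lambda>n. norm ((frac_coeff d (Suc n))\<^sup>2) \<le> B\<^sup>2 * real n powr (2 * d - 2)) sequentially"
      using frac_coeff_Suc_eq_rGamma_series[OF assms(1)] eventually_gt_at_top[of 0]
    proof eventually_elim
      case (elim n)
      have "real n powr d / (real n + 1) \<le> real n powr d / real n"
        using elim by (intro divide_left_mono) auto
      also have "\<dots> = real n powr (d - 1)" using elim by (simp add: powr_diff)
      finally have le: "real n powr d / (real n + 1) \<le> real n powr (d - 1)" .
      have "(frac_coeff d (Suc n))\<^sup>2 = (norm (rGamma_series d n))\<^sup>2 * (real n powr d / (real n + 1))\<^sup>2"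
        using elim by (simp only: real_norm_def power2_abs power_mult_distrib)
      also have "\<dots> \<le> B\<^sup>2 * (real n powr (d - 1))\<^sup>2"
        by (intro mult_mono power_mono B le) auto
      also have "\<dots> = B\<^sup>2 * real n powr (2 * d - 2)"
        using elim by (simp add: powr_power algebra_simps)
      finally show ?case by simp
    qed
  qed
  then show ?thesis by (subst (asm) summable_Suc_iff)
qed

text \<open>The positive coefficients are not summable, so convergence on the circle is only
  conditional. The binomial series is applied at \<open>t * z\<close> with \<open>t < 1\<close>,
  followed by an Abel-type passage to the boundary.\<close>

lemma frac_coeff_sums_powr:
  fixes z :: complex
  assumes d: "0 < d" "d < 1" and z: "norm z = 1" "z \<noteq> 1"
  shows "(\<lambda>k. of_real (frac_coeff d k) * z ^ k) sums (1 - z) powr (of_real (-d))"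
proof -
  let ?F = "at_left (1::real)"
  let ?L = "\<lambda>t. (1 - of_real t * z) powr (of_real (-d) :: complex)"
  \<comment> \<open>This keeps \<open>1 - z\<close> off the branch cut, so the principal power is
    continuous there.\<close>
  have Re1: "Re z < 1"
  proof (rule ccontr)
    assume "\<not> Re z < 1"
    then have "Re z = 1" using complex_Re_le_cmod[of z] z by simp
    moreover from this have "Im z = 0" using z cmod_power2[of z] by simp
    ultimately show False using z by (simp add: complex_eq_iff)
  qed
  have c: "(of_real (-d) :: complex) gchoose k = of_real (frac_coeff d k) * (-1) ^ k" for k
    using d by (simp add: frac_coeff_eq_pochhammer gbinomial_pochhammer pochhammer_of_real)
  \<comment> \<open>The tail bound is uniform in the radius \<open>t\<close>, so letting \<open>t\<close> tend to 1 also gives convergence at \<open>z\<close>.\<close>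
  have tail: "norm (?L t - (\<Sum>k<m. of_real (frac_coeff d k) * (of_real t * z) ^ k))
      \<le> 2 * frac_coeff d m / norm (1 - of_real t * z)" if t: "0 < t" "t < 1" for t m
  proof -
    \<comment> \<open>The general binomial series expands a power of \<open>1 + x\<close>; taking
      \<open>x = - t * z\<close> cancels the sign \<open>(-1) ^ k\<close> in
      \<open>c\<close>.\<close>
    have "norm (- of_real t * z) < 1" using z t by (simp add: norm_mult)
    from gen_binomial_complex[OF this, of "of_real (-d)"]
    have s: "(\<lambda>k. of_real (frac_coeff d k) * (of_real t * z) ^ k) sums ?L t"
      unfolding c mult.assoc by (simp flip: power_mult_distrib)
    then have "(\<lambda>n. norm ((\<Sum>k<n. of_real (frac_coeff d k) * (of_real t * z) ^ k)
        - (\<Sum>k<m. of_real (frac_coeff d k) * (of_real t * z) ^ k)))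
      \<longlonglongrightarrow> norm (?L t - (\<Sum>k<m. of_real (frac_coeff d k) * (of_real t * z) ^ k))"
      unfolding sums_def by (intro tendsto_intros)
    moreover have "norm ((\<Sum>k<n. of_real (frac_coeff d k) * (of_real t * z) ^ k)
        - (\<Sum>k<m. of_real (frac_coeff d k) * (of_real t * z) ^ k))
      \<le> 2 * frac_coeff d m / norm (1 - of_real t * z)" if "n \<ge> m" for n
    proof -
      have "(\<Sum>k<n. of_real (frac_coeff d k) * (of_real t * z) ^ k)
        - (\<Sum>k<m. of_real (frac_coeff d k) * (of_real t * z) ^ k)
        = (\<Sum>k=m..<n. of_real (frac_coeff d k) * (of_real t * z) ^ k)"
        using that by (simp add: sum_diff_nat_ivl lessThan_atLeast0)
      moreover have "of_real t * z \<noteq> 1"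
        using z t by (metis abs_of_pos less_irrefl mult.right_neutral norm_mult norm_of_real norm_one)
      ultimately show ?thesis
        using norm_decseq_power_sum_le[of "frac_coeff d" "of_real t * z" m n] that z t d
          decseq_frac_coeff[of d] frac_coeff_pos[of d] by (simp add: norm_mult less_imp_le)
    qed
    ultimately show ?thesis
      by (intro LIMSEQ_le_const2) auto
  qed
  have lim: "norm ((1 - z) powr (of_real (-d)) - (\<Sum>k<m. of_real (frac_coeff d k) * z ^ k))
      \<le> 2 * frac_coeff d m / norm (1 - z)" for m
  proof (rule tendsto_le)
    show "eventually (\<lambda>t. norm (?L t - (\<Sum>k<m. of_real (frac_coeff d k) * (of_real t * z) ^ k))
      \<le> 2 * frac_coeff d m / norm (1 - of_real t * z)) ?F"
      using eventually_at_left_real[OF zero_less_one] by eventually_elim (use tail in auto)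
    have "((\<lambda>t. of_real t :: complex) \<longlongrightarrow> of_real 1) ?F" by (intro tendsto_intros)
    then have t1: "((\<lambda>t. of_real t :: complex) \<longlongrightarrow> 1) ?F" by simp
    have n: "1 - 1 * z \<notin> \<real>\<^sub>\<le>\<^sub>0" using Re1 by (auto simp: complex_nonpos_Reals_iff)
    show "((\<lambda>t. 2 * frac_coeff d m / norm (1 - of_real t * z)) \<longlongrightarrow> 2 * frac_coeff d m / norm (1 - z)) ?F"
      using z by (auto intro!: tendsto_eq_intros t1)
    have "((\<lambda>t. norm (?L t - (\<Sum>k<m. of_real (frac_coeff d k) * (of_real t * z) ^ k)))
       \<longlongrightarrow> norm ((1 - 1 * z) powr (of_real (-d)) - (\<Sum>k<m. of_real (frac_coeff d k) * (1 * z) ^ k))) ?F"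
      by (intro tendsto_intros t1 disjI1 n)
    then show "((\<lambda>t. norm (?L t - (\<Sum>k<m. of_real (frac_coeff d k) * (of_real t * z) ^ k)))
       \<longlongrightarrow> norm ((1 - z) powr (of_real (-d)) - (\<Sum>k<m. of_real (frac_coeff d k) * z ^ k))) ?F"
      by simp
  qed simp
  have "(\<lambda>m. 2 * frac_coeff d m / norm (1 - z)) \<longlonglongrightarrow> 2 * 0 / norm (1 - z)"
    using z by (intro tendsto_intros frac_coeff_tendsto_0 d) auto
  then have lim0: "(\<lambda>m. 2 * frac_coeff d m / norm (1 - z)) \<longlonglongrightarrow> 0" by simp
  have "(\<lambda>m. (\<Sum>k<m. of_real (frac_coeff d k) * z ^ k) - (1 - z) powr (of_real (-d))) \<longlonglongrightarrow> 0"
    by (rule Lim_null_comparison[OF always_eventually[OF allI] lim0])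
      (use lim in \<open>simp add: norm_minus_commute\<close>)
  then show ?thesis unfolding sums_def by (rule LIM_zero_cancel)
qed


text \<open>The finite form of the fact that a squared transfer function has the autocorrelations of
  its weights as Fourier coefficients. In the induction the new term meets the \<open>k\<close>-th
  one at lag \<open>N - k\<close>, which adds exactly one product to each autocorrelation.\<close>

lemma norm_sq_power_sum:
  fixes c :: "nat \<Rightarrow> real" and z :: complex
  assumes "norm z = 1"
  shows "(norm (\<Sum>k<N. of_real (c k) * z ^ k))\<^sup>2
       = 2 * Re (\<Sum>h<N. of_real (\<Sum>k<N-h. c k * c (k + h)) * z ^ h) - (\<Sum>k<N. c k * c k)"
proof (induction N)
  case 0
  show ?case by simp
next
  case (Suc N)
  let ?P = "\<Sum>k<N. of_real (c k) * z ^ k"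
  let ?r = "\<lambda>N h. \<Sum>k<N-h. c k * c (k + h)"
  have zz: "cnj (z ^ k) * z ^ N = z ^ (N - k)" if "k \<le> N" for k
  proof -
    have "cnj z * z = 1" using assms complex_norm_square[of z] by (simp add: mult.commute)
    then have "cnj z ^ k * z ^ k = 1" by (simp flip: power_mult_distrib)
    moreover have "z ^ N = z ^ k * z ^ (N - k)" using that by (simp flip: power_add)
    ultimately show ?thesis by (simp add: mult.assoc[symmetric])
  qed
  have norm_sum: "(norm (p + q))\<^sup>2 = (norm p)\<^sup>2 + (norm q)\<^sup>2 + 2 * Re (cnj p * q)" for p q :: complex
    unfolding cmod_power2 by (simp add: power2_eq_square algebra_simps)
  have "(norm (?P + of_real (c N) * z ^ N))\<^sup>2
      = (norm ?P)\<^sup>2 + (norm (of_real (c N) * z ^ N))\<^sup>2 + 2 * Re (cnj ?P * (of_real (c N) * z ^ N))"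
    by (rule norm_sum)
  also have "norm (of_real (c N) * z ^ N) = \<bar>c N\<bar>"
    using assms by (simp add: norm_mult norm_power)
  also have "cnj ?P * (of_real (c N) * z ^ N) = (\<Sum>k<N. of_real (c k * c N) * (cnj (z ^ k) * z ^ N))"
    by (simp add: sum_distrib_left sum_distrib_right mult_ac)
  also have "\<dots> = (\<Sum>k<N. of_real (c k * c N) * z ^ (N - k))"
    by (intro sum.cong refl arg_cong2[of _ _ _ _ "(*)"] zz) auto
  also have "\<dots> = (\<Sum>h\<in>{1..N}. of_real (c (N - h) * c N) * z ^ h)"
    by (rule sum.reindex_bij_witness[of _ "\<lambda>h. N - h" "\<lambda>k. N - k"]) auto
  \<comment> \<open>Lag 0 is added and subtracted again, so that the range matches that of the
    autocorrelations.\<close>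
  also have "\<dots> = (\<Sum>h\<le>N. of_real (c (N - h) * c N) * z ^ h) - of_real (c N * c N)"
    by (simp add: atMost_atLeast0 sum.atLeast_Suc_atMost)
  finally have 1: "(norm (?P + of_real (c N) * z ^ N))\<^sup>2 = (norm ?P)\<^sup>2
      + 2 * Re (\<Sum>h\<le>N. of_real (c (N - h) * c N) * z ^ h) - c N * c N"
    by (simp add: power2_eq_square)
  have "(\<Sum>h\<le>N. of_real (?r (Suc N) h) * z ^ h)
      = (\<Sum>h\<le>N. of_real (?r N h) * z ^ h + of_real (c (N - h) * c N) * z ^ h)"
    by (intro sum.cong refl) (simp add: Suc_diff_le distrib_right)
  \<comment> \<open>At \<open>h = N\<close> the old autocorrelation \<open>?r N N\<close> is an
    empty sum.\<close>
  also have "\<dots> = (\<Sum>h<N. of_real (?r N h) * z ^ h) + (\<Sum>h\<le>N. of_real (c (N - h) * c N) * z ^ h)"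
    by (simp add: sum.distrib lessThan_Suc_atMost[symmetric])
  finally show ?case
    using 1 Suc.IH by (simp add: lessThan_Suc_atMost[symmetric])
qed

text \<open>Two limits are taken in turn. For fixed \<open>m\<close> the finite identity for
  \<open>N\<close> terms is split at lag \<open>m\<close>, and summation by parts bounds the tail
  uniformly in \<open>N\<close>. Letting \<open>N\<close> and then \<open>m\<close> tend to infinity
  gives the claim, because \<open>r\<close> tends to 0.\<close>

lemma autocorrelation_power_series:
  fixes c :: "nat \<Rightarrow> real" and z P :: complex
  assumes dec: "decseq c" and nonneg: "\<And>k. 0 \<le> c k" and sq: "summable (\<lambda>k. (c k)\<^sup>2)"
    and z: "norm z = 1" "z \<noteq> 1" and P: "(\<lambda>k. of_real (c k) * z ^ k) sums P"
  defines "r \<equiv> \<lambda>h. \<Sum>k. c k * c (k + h)"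
  shows "(\<lambda>m. 2 * Re (\<Sum>h<m. of_real (r h) * z ^ h) - r 0) \<longlonglongrightarrow> (norm P)\<^sup>2"
proof -
  define rN where "rN N h = (\<Sum>k<N-h. c k * c (k + h))" for N h
  have cc: "norm (c k * c (k + h)) \<le> (c k)\<^sup>2" for k h
    using mult_left_mono[OF decseqD[OF dec, of k "k + h"] nonneg[of k]] nonneg
    by (simp add: power2_eq_square)
  have summ: "summable (\<lambda>k. c k * c (k + h))" for h
    by (rule summable_comparison_test'[OF sq]) (rule cc)
  have rN_le: "rN N h \<le> r h" for N h
    unfolding rN_def r_def by (intro sum_le_suminf summ) (auto intro!: mult_nonneg_nonneg nonneg)
  have rN_nonneg: "0 \<le> rN N h" for N h
    unfolding rN_def by (intro sum_nonneg mult_nonneg_nonneg nonneg)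
  have rN_dec: "decseq (rN N)" for N
  proof (rule decseq_SucI)
    fix h
    \<comment> \<open>A larger lag shrinks the second factor, since \<open>c\<close> decreases, and
      also shortens the sum.\<close>
    have "rN N (Suc h) \<le> (\<Sum>k<N - Suc h. c k * c (k + h))"
      unfolding rN_def by (intro sum_mono mult_left_mono nonneg decseqD[OF dec]) auto
    also have "\<dots> \<le> rN N h"
      unfolding rN_def by (intro sum_mono2) (auto intro!: mult_nonneg_nonneg nonneg)
    finally show "rN N (Suc h) \<le> rN N h" .
  qed
  have rN_lim: "(\<lambda>N. rN N h) \<longlonglongrightarrow> r h" for h
  proof -
    have "(\<lambda>N. \<Sum>k<N. c k * c (k + h)) \<longlonglongrightarrow> r h"
      unfolding r_def using summ summable_LIMSEQ by blast
    then have "(\<lambda>N. rN (N + h) h) \<longlonglongrightarrow> r h" by (simp add: rN_def)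
    then show ?thesis by (rule LIMSEQ_offset)
  qed
  have c0: "c \<longlonglongrightarrow> 0"
  proof -
    have "(\<lambda>k. sqrt ((c k)\<^sup>2)) \<longlonglongrightarrow> sqrt 0"
      by (intro tendsto_real_sqrt summable_LIMSEQ_zero sq)
    then show ?thesis using nonneg by simp
  qed
  \<comment> \<open>Dominated convergence for series: each term vanishes as the lag grows, and the
    squares of \<open>c\<close> dominate.\<close>
  have r0: "r \<longlonglongrightarrow> 0"
  proof -
    have "((\<lambda>h. \<Sum>k. c k * c (k + h)) \<longlongrightarrow> (\<Sum>k. 0)) sequentially"
    proof (rule conjunct2[OF conjunct2[OF tannerys_theorem]])
      show "((\<lambda>h. c k * c (k + h)) \<longlongrightarrow> 0) sequentially" for k
        using tendsto_mult[OF tendsto_const[of "c k"] LIMSEQ_ignore_initial_segment[OF c0, of k]]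
        by (simp add: add.commute)
      show "eventually (\<lambda>(k, h). norm (c k * c (k + h)) \<le> (c k)\<^sup>2) (at_top \<times>\<^sub>F sequentially)"
        by (rule always_eventually) (use cc in auto)
    qed (use sq in auto)
    then show ?thesis by (simp add: r_def)
  qed
  have bound: "\<bar>(norm P)\<^sup>2 - (2 * Re (\<Sum>h<m. of_real (r h) * z ^ h) - r 0)\<bar>
      \<le> 4 * r m / norm (1 - z)" for m
  proof (rule LIMSEQ_le_const2)
    have "(\<lambda>N. \<bar>(norm (\<Sum>k<N. of_real (c k) * z ^ k))\<^sup>2
        - (2 * Re (\<Sum>h<m. of_real (rN N h) * z ^ h) - rN N 0)\<bar>)
      \<longlonglongrightarrow> \<bar>(norm P)\<^sup>2 - (2 * Re (\<Sum>h<m. of_real (r h) * z ^ h) - r 0)\<bar>"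
      using P unfolding sums_def by (intro tendsto_intros rN_lim)
    then show "(\<lambda>N. \<bar>(norm (\<Sum>k<N. of_real (c k) * z ^ k))\<^sup>2
        - (2 * Re (\<Sum>h<m. of_real (rN N h) * z ^ h) - rN N 0)\<bar>)
      \<longlonglongrightarrow> \<bar>(norm P)\<^sup>2 - (2 * Re (\<Sum>h<m. of_real (r h) * z ^ h) - r 0)\<bar>" .
    show "\<exists>N0. \<forall>N\<ge>N0. \<bar>(norm (\<Sum>k<N. of_real (c k) * z ^ k))\<^sup>2
        - (2 * Re (\<Sum>h<m. of_real (rN N h) * z ^ h) - rN N 0)\<bar> \<le> 4 * r m / norm (1 - z)"
    proof (intro exI[of _ m] allI impI)
      fix N assume N: "m \<le> N"
      let ?T = "\<Sum>h=m..<N. of_real (rN N h) * z ^ h"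
      have "(\<Sum>h<N. of_real (rN N h) * z ^ h) = (\<Sum>h<m. of_real (rN N h) * z ^ h) + ?T"
        using N by (simp add: lessThan_atLeast0 sum.atLeastLessThan_concat)
      then have "(norm (\<Sum>k<N. of_real (c k) * z ^ k))\<^sup>2
        - (2 * Re (\<Sum>h<m. of_real (rN N h) * z ^ h) - rN N 0) = 2 * Re ?T"
        using norm_sq_power_sum[OF z(1), of c N] by (simp add: rN_def)
      moreover have "\<bar>Re ?T\<bar> \<le> 2 * rN N m / norm (1 - z)"
        by (rule order_trans[OF abs_Re_le_cmod norm_decseq_power_sum_le[OF rN_dec rN_nonneg _ z(2) N]])
          (use z in simp)
      moreover have "2 * rN N m / norm (1 - z) \<le> 2 * r m / norm (1 - z)"
        using rN_le by (intro divide_right_mono) auto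
      ultimately show "\<bar>(norm (\<Sum>k<N. of_real (c k) * z ^ k))\<^sup>2
        - (2 * Re (\<Sum>h<m. of_real (rN N h) * z ^ h) - rN N 0)\<bar> \<le> 4 * r m / norm (1 - z)"
        by simp
    qed
  qed
  have "(\<lambda>m. 4 * r m / norm (1 - z)) \<longlonglongrightarrow> 4 * 0 / norm (1 - z)"
    using z by (intro tendsto_intros r0) auto
  then have lim0: "(\<lambda>m. 4 * r m / norm (1 - z)) \<longlonglongrightarrow> 0" by simp
  have "(\<lambda>m. (2 * Re (\<Sum>h<m. of_real (r h) * z ^ h) - r 0) - (norm P)\<^sup>2) \<longlonglongrightarrow> 0"
    by (rule Lim_null_comparison[OF always_eventually[OF allI] lim0])
      (use bound in \<open>simp add: abs_minus_commute\<close>)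
  then show ?thesis by (rule LIM_zero_cancel)
qed

section \<open>Symmetric partial sums of the spectral series\<close>

text \<open>The autocovariance at lag \<open>h\<close> of scalar fractional noise with innovations
  of unit variance.\<close>

definition frac_acv :: "real \<Rightarrow> nat \<Rightarrow> real" where
  "frac_acv d h = (\<Sum>k. frac_coeff d k * frac_coeff d (k + h))"

definition transfer :: "real \<Rightarrow> real \<Rightarrow> real \<Rightarrow> real \<Rightarrow> real" where
  "transfer d q0 q1 \<theta> = Re (Complex q0 q1 * (1 - cis \<theta>) powr of_real (- d))"

text \<open>The real part of \<open>(q0 + i q1)^2 * cis x\<close>.\<close>

definition phase :: "real \<Rightarrow> real \<Rightarrow> real \<Rightarrow> real" where
  "phase q0 q1 x = (q0\<^sup>2 - q1\<^sup>2) * cos x - 2 * q0 * q1 * sin x"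

text \<open>The autocovariance of one component, as \<open>FRMod0d0_moments\<close> shows. The
  factor 2 at lag 0 arises because the conditions \<open>k + l = h\<close> and
  \<open>k + l = - h\<close> of \<open>cov_kernel\<close> coincide there.\<close>

definition frmod_acv :: "real \<Rightarrow> real \<Rightarrow> real \<Rightarrow> real \<Rightarrow> nat \<Rightarrow> real" where
  "frmod_acv l0 d q0 q1 h = 2 * (q0\<^sup>2 + q1\<^sup>2) * frac_acv d h * cos (real h * l0)
     + (if h = 0 then 2 else 1) * (frac_coeff (2 * d) h * phase q0 q1 (real h * l0))"

text \<open>
  Covariance at lag \<open>h\<close> of the normalized \<open>k\<close>-th and \<open>l\<close>-th innovation terms: the first summand comes from
  pairing a past with a future innovation, the second from pairing two of the same kind.
\<close>

definition cov_kernel :: "real \<Rightarrow> real \<Rightarrow> real \<Rightarrow> int \<Rightarrow> nat \<Rightarrow> nat \<Rightarrow> real" where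
  "cov_kernel l0 q0 q1 h k l =
     phase q0 q1 (real (k + l) * l0) * (of_bool (int k + int l = h) + of_bool (int k + int l = - h))
     + (q0\<^sup>2 + q1\<^sup>2) * cos ((real k - real l) * l0) *
       (of_bool (int k - int l = h) + of_bool (int k - int l = - h))"

lemma transfer_sums:
  assumes d: "0 < d" "d < 1" and \<theta>: "cis \<theta> \<noteq> 1"
  shows "(\<lambda>k. frac_coeff d k * (q0 * cos (real k * \<theta>) - q1 * sin (real k * \<theta>))) sums transfer d q0 q1 \<theta>"
proof -
  have "(\<lambda>k. Re (Complex q0 q1 * (of_real (frac_coeff d k) * cis \<theta> ^ k))) sums transfer d q0 q1 \<theta>"
    unfolding transfer_def
    by (intro sums_Re sums_mult frac_coeff_sums_powr) (use assms in auto)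
  then show ?thesis by (simp add: Complex.DeMoivre algebra_simps)
qed

text \<open>For a complex \<open>w\<close>, twice the square of \<open>Re w\<close> is
  \<open>(norm w)^2 + Re (w^2)\<close>. With \<open>w = a * ?P\<close> the first part expands by
  autocorrelations, while the second contains the square of \<open>?P\<close>, again a binomial
  series because \<open>2 * d < 1\<close>.\<close>

lemma transfer_square_series:
  assumes d: "0 < d" "d < 1/2" and \<theta>: "cis \<theta> \<noteq> 1"
  shows "(\<lambda>N. (q0\<^sup>2 + q1\<^sup>2) * (2 * (\<Sum>h<N. frac_acv d h * cos (real h * \<theta>)) - frac_acv d 0)
       + (\<Sum>h<N. frac_coeff (2 * d) h * phase q0 q1 (real h * \<theta>)))
     \<longlonglongrightarrow> 2 * (transfer d q0 q1 \<theta>)\<^sup>2"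
proof -
  let ?P = "(1 - cis \<theta>) powr of_real (- d)"
  define a where "a = Complex q0 q1"
  have 1: "(\<lambda>N. 2 * (\<Sum>h<N. frac_acv d h * cos (real h * \<theta>)) - frac_acv d 0) \<longlonglongrightarrow> (norm ?P)\<^sup>2"
    using autocorrelation_power_series[OF decseq_frac_coeff less_imp_le[OF frac_coeff_pos]
        summable_frac_coeff_square norm_cis \<theta> frac_coeff_sums_powr] d \<theta>
    by (simp add: frac_acv_def Complex.DeMoivre)
  have "(\<lambda>N. Re (a\<^sup>2 * (\<Sum>h<N. of_real (frac_coeff (2 * d) h) * cis \<theta> ^ h)))
      \<longlonglongrightarrow> Re (a\<^sup>2 * (1 - cis \<theta>) powr of_real (- (2 * d)))"
    by (intro tendsto_intros frac_coeff_sums_powr[unfolded sums_def]) (use assms in auto)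
  also have "(1 - cis \<theta>) powr of_real (- (2 * d)) = ?P\<^sup>2"
    by (simp add: power2_eq_square flip: powr_add)
  also have "(\<lambda>N. Re (a\<^sup>2 * (\<Sum>h<N. of_real (frac_coeff (2 * d) h) * cis \<theta> ^ h)))
      = (\<lambda>N. \<Sum>h<N. frac_coeff (2 * d) h * phase q0 q1 (real h * \<theta>))"
    by (simp add: a_def sum_distrib_left Complex.DeMoivre phase_def algebra_simps power2_eq_square)
  finally have 2: "(\<lambda>N. \<Sum>h<N. frac_coeff (2 * d) h * phase q0 q1 (real h * \<theta>)) \<longlonglongrightarrow> Re (a\<^sup>2 * ?P\<^sup>2)" .
  have "(q0\<^sup>2 + q1\<^sup>2) * (norm ?P)\<^sup>2 + Re (a\<^sup>2 * ?P\<^sup>2) = (norm (a * ?P))\<^sup>2 + Re ((a * ?P)\<^sup>2)"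
    by (simp add: norm_mult power_mult_distrib a_def complex_norm)
  also have "\<dots> = 2 * (Re (a * ?P))\<^sup>2"
    by (simp only: cmod_power2) (simp add: power2_eq_square)
  also have "\<dots> = 2 * (transfer d q0 q1 \<theta>)\<^sup>2" by (simp only: transfer_def a_def)
  finally show ?thesis
    using tendsto_add[OF tendsto_mult[OF tendsto_const 1] 2, of "q0\<^sup>2 + q1\<^sup>2"] by simp
qed

lemma spectral_partial_sum_even:
  assumes "\<And>h. \<gamma> (- h) = \<gamma> h"
  shows "spectral_partial_sum \<gamma> l N
     = of_real (2 * (\<Sum>h<Suc N. \<gamma> (int h) * cos (real h * l)) - \<gamma> 0)"
proof (induction N)
  case 0
  show ?case by (simp add: spectral_partial_sum_def)
next
  case (Suc N)
  let ?t = "\<lambda>h. cis (- (of_int h * l)) * complex_of_real (\<gamma> h)"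
  have "{- int (Suc N)..int (Suc N)} = insert (- int (Suc N)) (insert (int (Suc N)) {- int N..int N})"
    by auto
  then have "spectral_partial_sum \<gamma> l (Suc N)
      = ?t (- int (Suc N)) + (?t (int (Suc N)) + spectral_partial_sum \<gamma> l N)"
    unfolding spectral_partial_sum_def by (simp del: of_nat_Suc)
  also have "?t (- int (Suc N)) + (?t (int (Suc N)) + spectral_partial_sum \<gamma> l N)
     = of_real (2 * (\<gamma> (int (Suc N)) * cos (real (Suc N) * l))) + spectral_partial_sum \<gamma> l N"
    by (simp add: assms complex_eq_iff del: of_nat_Suc)
  finally show ?case unfolding Suc.IH by simp
qed

text \<open>By the addition formulas each lag contributes one term at \<open>l0 + l\<close> and one
  at \<open>l0 - l\<close>. The symmetric partial sum therefore consists of two copies of the sums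
  in \<open>transfer_square_series\<close>, exactly and for every \<open>N\<close>.\<close>

lemma spectral_partial_sum_frmod:
  assumes d: "0 < d" "d < 1/2" and \<gamma>: "\<And>h. \<gamma> h = frmod_acv l0 d q0 q1 (nat \<bar>h\<bar>)"
    and l: "cis (l0 + l) \<noteq> 1" "cis (l0 - l) \<noteq> 1"
  shows "spectral_partial_sum \<gamma> l \<longlonglongrightarrow>
     of_real (2 * (transfer d q0 q1 (l0 + l))\<^sup>2 + 2 * (transfer d q0 q1 (l0 - l))\<^sup>2)"
proof -
  define T where "T \<theta> N = (q0\<^sup>2 + q1\<^sup>2) * (2 * (\<Sum>h<N. frac_acv d h * cos (real h * \<theta>)) - frac_acv d 0)
       + (\<Sum>h<N. frac_coeff (2 * d) h * phase q0 q1 (real h * \<theta>))" for \<theta> and N :: nat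
  have "2 * (\<Sum>h<Suc N. \<gamma> (int h) * cos (real h * l)) - \<gamma> 0 = T (l0 + l) (Suc N) + T (l0 - l) (Suc N)" for N
  proof (induction N)
    case 0
    \<comment> \<open>The double weight of \<open>phase\<close> at lag 0 supplies one such term to
      each copy.\<close>
    show ?case by (simp add: \<gamma> frmod_acv_def T_def phase_def algebra_simps)
  next
    case (Suc N)
    define h where "h = Suc N"
    have h: "h \<noteq> 0" by (simp add: h_def)
    have T_Suc: "T \<theta> (Suc h) = T \<theta> h + (2 * (q0\<^sup>2 + q1\<^sup>2) * frac_acv d h * cos (real h * \<theta>)
        + frac_coeff (2 * d) h * phase q0 q1 (real h * \<theta>))" for \<theta>
      by (simp add: T_def algebra_simps)
    have "2 * (\<Sum>h<Suc h. \<gamma> (int h) * cos (real h * l)) - \<gamma> 0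
       = T (l0 + l) h + T (l0 - l) h + 2 * (\<gamma> (int h) * cos (real h * l))"
      using Suc by (simp add: h_def del: of_nat_Suc)
    also have "2 * (\<gamma> (int h) * cos (real h * l))
      = (2 * (q0\<^sup>2 + q1\<^sup>2) * frac_acv d h * cos (real h * (l0 + l))
        + frac_coeff (2 * d) h * phase q0 q1 (real h * (l0 + l)))
      + (2 * (q0\<^sup>2 + q1\<^sup>2) * frac_acv d h * cos (real h * (l0 - l))
        + frac_coeff (2 * d) h * phase q0 q1 (real h * (l0 - l)))"
      using h by (simp add: \<gamma> frmod_acv_def phase_def distrib_left right_diff_distrib
          cos_add cos_diff sin_add sin_diff) (simp add: algebra_simps)
    finally show ?case unfolding h_def[symmetric] T_Suc by simp
  qed
  moreover have "(\<lambda>N. T (l0 + l) (Suc N) + T (l0 - l) (Suc N))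
      \<longlonglongrightarrow> 2 * (transfer d q0 q1 (l0 + l))\<^sup>2 + 2 * (transfer d q0 q1 (l0 - l))\<^sup>2"
    unfolding T_def
    by (intro tendsto_add LIMSEQ_Suc transfer_square_series d l)
  ultimately have "(\<lambda>N. 2 * (\<Sum>h<Suc N. \<gamma> (int h) * cos (real h * l)) - \<gamma> 0)
      \<longlonglongrightarrow> 2 * (transfer d q0 q1 (l0 + l))\<^sup>2 + 2 * (transfer d q0 q1 (l0 - l))\<^sup>2"
    by simp
  moreover have "spectral_partial_sum \<gamma> l
      = (\<lambda>N. of_real (2 * (\<Sum>h<Suc N. \<gamma> (int h) * cos (real h * l)) - \<gamma> 0))"
    by (intro ext spectral_partial_sum_even) (simp add: \<gamma>)
  ultimately show ?thesis by (simp only: tendsto_of_real)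
qed

text \<open>The kernel lives on antidiagonals and diagonals. An antidiagonal carries the
  self-convolution, complete as soon as \<open>N\<close> exceeds the lag; a diagonal carries a
  truncated autocorrelation, which tends to \<open>frac_acv\<close>.\<close>

lemma cov_kernel_sum_tendsto:
  assumes d: "0 < d" "d < 1/2"
  shows "(\<lambda>N. \<Sum>k<N. \<Sum>l<N. frac_coeff d k * frac_coeff d l * cov_kernel l0 q0 q1 h k l)
     \<longlonglongrightarrow> frmod_acv l0 d q0 q1 (nat \<bar>h\<bar>)"
proof -
  define m where "m = nat \<bar>h\<bar>"
  let ?c = "frac_coeff d"
  have summ: "summable (\<lambda>k. ?c k * ?c (k + m))"
  proof (rule summable_comparison_test'[OF summable_frac_coeff_square[OF d]])
    show "norm (?c k * ?c (k + m)) \<le> (?c k)\<^sup>2" for k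
      using mult_left_mono[OF decseqD[OF decseq_frac_coeff, of d k "k + m"], of "?c k"]
        frac_coeff_pos[of d k] frac_coeff_pos[of d "k + m"] d
      by (simp add: power2_eq_square)
  qed
  have kernel: "cov_kernel l0 q0 q1 h k l =
      (if m = 0 then 2 else 1) * phase q0 q1 (real m * l0) * of_bool (k + l = m)
      + (q0\<^sup>2 + q1\<^sup>2) * cos (real m * l0) * (of_bool (k = l + m) + of_bool (l = k + m))" for k l
  proof -
    have 1: "phase q0 q1 (real (k + l) * l0) * (of_bool (int k + int l = h) + of_bool (int k + int l = - h))
      = (if m = 0 then 2 else 1) * phase q0 q1 (real m * l0) * of_bool (k + l = m)"
    proof (cases "k + l = m")
      case True
      then have "of_bool (int k + int l = h) + of_bool (int k + int l = - h) = (if m = 0 then 2 else 1 :: real)"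
        by (cases "h \<ge> 0") (auto simp: m_def)
      then show ?thesis unfolding True by simp
    qed (auto simp: m_def)
    have "int k - int l = h \<or> int k - int l = - h \<Longrightarrow> cos ((real k - real l) * l0) = cos (real m * l0)"
    proof -
      assume "int k - int l = h \<or> int k - int l = - h"
      then have "real k - real l = real m \<or> real k - real l = - real m" by (auto simp: m_def)
      then show ?thesis by (metis cos_minus minus_mult_left)
    qed
    moreover have "of_bool (int k - int l = h) + of_bool (int k - int l = - h)
        = (of_bool (k = l + m) + of_bool (l = k + m) :: real)"
      by (cases "h \<ge> 0") (auto simp: m_def)
    ultimately have "cos ((real k - real l) * l0) *
       (of_bool (int k - int l = h) + of_bool (int k - int l = - h))
       = cos (real m * l0) * (of_bool (k = l + m) + of_bool (l = k + m))"
      by (cases "int k - int l = h \<or> int k - int l = - h") auto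
    then show ?thesis unfolding cov_kernel_def 1 by (simp add: mult.assoc)
  qed
  have S1: "(\<Sum>k<N. \<Sum>l<N. ?c k * ?c l * of_bool (k + l = m)) = frac_coeff (2 * d) m" if N: "N > m" for N
  proof -
    \<comment> \<open>On \<open>nat\<close> the difference \<open>m - k\<close> is 0 for
      \<open>k > m\<close>; the inner test discards that case.\<close>
    have "(\<Sum>k<N. \<Sum>l<N. ?c k * ?c l * of_bool (k + l = m))
        = (\<Sum>k<N. \<Sum>l<N. if l = m - k then (if k \<le> m then ?c k * ?c (m - k) else 0) else 0)"
      by (intro sum.cong refl) auto
    also have "\<dots> = (\<Sum>k<N. if k \<le> m then ?c k * ?c (m - k) else 0)"
      using N by (intro sum.cong refl) (auto simp: sum.delta)
    also have "\<dots> = (\<Sum>k\<le>m. ?c k * ?c (m - k))"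
      using N by (intro sum.mono_neutral_cong_right) auto
    finally show ?thesis using frac_coeff_convolution[of d m] d by simp
  qed
  have S2: "(\<Sum>k<N. \<Sum>l<N. ?c k * ?c l * of_bool (l = k + m)) = (\<Sum>k<N-m. ?c k * ?c (k + m))" for N
  proof -
    have "(\<Sum>k<N. \<Sum>l<N. ?c k * ?c l * of_bool (l = k + m))
        = (\<Sum>k<N. \<Sum>l<N. if l = k + m then ?c k * ?c (k + m) else 0)"
      by (intro sum.cong refl) auto
    also have "\<dots> = (\<Sum>k<N. if k + m < N then ?c k * ?c (k + m) else 0)"
      by (intro sum.cong refl) (auto simp: sum.delta)
    also have "\<dots> = (\<Sum>k<N-m. ?c k * ?c (k + m))"
      by (intro sum.mono_neutral_cong_right) auto
    finally show ?thesis .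
  qed
  have S3: "(\<Sum>k<N. \<Sum>l<N. ?c k * ?c l * of_bool (k = l + m)) = (\<Sum>k<N-m. ?c k * ?c (k + m))" for N
    by (subst sum.swap, subst S2[symmetric]) (simp add: mult.commute)
  have "eventually (\<lambda>N. (\<Sum>k<N. \<Sum>l<N. ?c k * ?c l * cov_kernel l0 q0 q1 h k l)
     = (if m = 0 then 2 else 1) * phase q0 q1 (real m * l0) * frac_coeff (2 * d) m
       + 2 * (q0\<^sup>2 + q1\<^sup>2) * cos (real m * l0) * (\<Sum>k<N-m. ?c k * ?c (k + m))) sequentially"
    using eventually_gt_at_top[of m]
  proof eventually_elim
    case (elim N)
    let ?A = "(if m = 0 then 2 else 1) * phase q0 q1 (real m * l0)"
    let ?B = "(q0\<^sup>2 + q1\<^sup>2) * cos (real m * l0)"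
    have "(\<Sum>k<N. \<Sum>l<N. ?c k * ?c l * cov_kernel l0 q0 q1 h k l)
      = ?A * (\<Sum>k<N. \<Sum>l<N. ?c k * ?c l * of_bool (k + l = m))
        + ?B * (\<Sum>k<N. \<Sum>l<N. ?c k * ?c l * of_bool (k = l + m))
        + ?B * (\<Sum>k<N. \<Sum>l<N. ?c k * ?c l * of_bool (l = k + m))"
      unfolding kernel sum_distrib_left sum.distrib[symmetric]
      by (intro sum.cong refl) (simp add: algebra_simps)
    then show ?case unfolding S1[OF elim] S2 S3 by simp
  qed
  moreover have "(\<lambda>N. (if m = 0 then 2 else 1) * phase q0 q1 (real m * l0) * frac_coeff (2 * d) m
       + 2 * (q0\<^sup>2 + q1\<^sup>2) * cos (real m * l0) * (\<Sum>k<N-m. ?c k * ?c (k + m)))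
    \<longlonglongrightarrow> (if m = 0 then 2 else 1) * phase q0 q1 (real m * l0) * frac_coeff (2 * d) m
       + 2 * (q0\<^sup>2 + q1\<^sup>2) * cos (real m * l0) * frac_acv d m"
  proof (intro tendsto_intros)
    have "(\<lambda>N. \<Sum>k<N. ?c k * ?c (k + m)) \<longlonglongrightarrow> frac_acv d m"
      unfolding frac_acv_def by (rule summable_LIMSEQ[OF summ])
    then have "(\<lambda>N. \<Sum>k<(N + m)-m. ?c k * ?c (k + m)) \<longlonglongrightarrow> frac_acv d m" by simp
    then show "(\<lambda>N. \<Sum>k<N-m. ?c k * ?c (k + m)) \<longlonglongrightarrow> frac_acv d m" by (rule LIMSEQ_offset)
  qed
  ultimately have "(\<lambda>N. \<Sum>k<N. \<Sum>l<N. ?c k * ?c l * cov_kernel l0 q0 q1 h k l)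
    \<longlonglongrightarrow> (if m = 0 then 2 else 1) * phase q0 q1 (real m * l0) * frac_coeff (2 * d) m
       + 2 * (q0\<^sup>2 + q1\<^sup>2) * cos (real m * l0) * frac_acv d m"
    by (simp add: tendsto_cong)
  then show ?thesis by (simp add: frmod_acv_def m_def[symmetric] algebra_simps)
qed

section \<open>Behaviour of the transfer function at the origin\<close>

text \<open>On this range the angle \<open>(t - pi) / 2\<close> of \<open>1 - cis t\<close> lies
  between \<open>- pi / 2\<close> and \<open>pi / 2\<close>, so \<open>Ln\<close> returns it
  unchanged and the principal power becomes explicit.\<close>

lemma transfer_eq:
  assumes t: "0 < t" "t < 2 * pi"
  shows "transfer d q0 q1 t
     = (2 * sin (t / 2)) powr (- d) * (q0 * cos (d * (pi - t) / 2) - q1 * sin (d * (pi - t) / 2))"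
proof -
  have s: "0 < sin (t / 2)" using t by (intro sin_gt_zero) auto
  have t2: "t = t / 2 + t / 2" by simp
  have "1 - cis t = of_real (2 * sin (t / 2)) * cis ((t - pi) / 2)"
  proof -
    have "1 - cos t = 2 * sin (t / 2) * sin (t / 2)"
      using cos_double_sin[of "t / 2"] by (simp add: power2_eq_square)
    moreover have "sin t = 2 * sin (t / 2) * cos (t / 2)"
      using sin_double[of "t / 2"] by simp
    moreover have "cos ((t - pi) / 2) = sin (t / 2)" "sin ((t - pi) / 2) = - cos (t / 2)"
      by (simp_all add: diff_divide_distrib cos_diff sin_diff)
    ultimately show ?thesis by (simp add: complex_eq_iff)
  qed
  moreover have "Ln (of_real (2 * sin (t / 2)) * cis ((t - pi) / 2))
      = of_real (ln (2 * sin (t / 2))) + of_real ((t - pi) / 2) * \<i>"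
    using s t by (subst Ln_times_of_real) (auto simp: Ln_cis Ln_of_real mult.commute[of "\<i>"] simp del: of_real_mult)
  moreover have "1 - cis t \<noteq> 0" using calculation(1) s by simp
  ultimately have "(1 - cis t) powr of_real (- d)
      = exp (of_real (- d) * (of_real (ln (2 * sin (t / 2))) + of_real ((t - pi) / 2) * \<i>))"
    by (simp add: powr_def)
  also have "\<dots> = of_real ((2 * sin (t / 2)) powr (- d)) * cis (d * (pi - t) / 2)"
  proof -
    have "of_real (- d) * (of_real (ln (2 * sin (t / 2))) + of_real ((t - pi) / 2) * \<i>)
        = of_real (- d * ln (2 * sin (t / 2))) + \<i> * of_real (d * (pi - t) / 2)"
      by (simp add: complex_eq_iff field_simps)
    then show ?thesis
      using s by (simp only: exp_add cis_conv_exp powr_def exp_of_real) simp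
  qed
  finally show ?thesis by (simp add: transfer_def algebra_simps)
qed

text \<open>Conjugation commutes with the principal power because \<open>1 - cis t\<close> has
  nonnegative real part; moving the conjugate to the coefficient flips \<open>q1\<close>. This
  reduces limits from the left of the origin to limits from the right.\<close>

lemma transfer_minus: "transfer d q0 q1 (- t) = transfer d q0 (- q1) t"
proof -
  have "1 - cis (- t) = cnj (1 - cis t)" by (simp add: complex_eq_iff)
  moreover have "cnj (1 - cis t) powr of_real (- d) = cnj ((1 - cis t) powr of_real (- d))"
    using cos_le_one[of t] by (subst cnj_powr) (auto simp del: complex_cnj_diff)
  ultimately show ?thesis by (simp add: transfer_def)
qed

text \<open>The ratio of \<open>t\<close> to \<open>2 * sin (t / 2)\<close> tends to 1 and the angle
  tends to \<open>d * pi / 2\<close>, so rescaling isolates the leading coefficient.\<close>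

lemma transfer_scaled_tendsto:
  "((\<lambda>t. t powr (2 * d) * (transfer d q0 q1 t)\<^sup>2)
     \<longlongrightarrow> (q0 * cos (d * pi / 2) - q1 * sin (d * pi / 2))\<^sup>2) (at_right 0)"
proof -
  have 1: "((\<lambda>t::real. (t / (2 * sin (t / 2))) powr (2 * d)) \<longlongrightarrow> 1 powr (2 * d)) (at_right 0)"
  proof (rule tendsto_powr)
    show "((\<lambda>t::real. t / (2 * sin (t / 2))) \<longlongrightarrow> 1) (at_right 0)" by real_asymp
  qed auto
  have 2: "((\<lambda>t. (q0 * cos (d * (pi - t) / 2) - q1 * sin (d * (pi - t) / 2))\<^sup>2)
     \<longlongrightarrow> (q0 * cos (d * (pi - 0) / 2) - q1 * sin (d * (pi - 0) / 2))\<^sup>2) (at_right 0)"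
    by (intro tendsto_intros) auto
  have "eventually (\<lambda>t. t powr (2 * d) * (transfer d q0 q1 t)\<^sup>2 = (t / (2 * sin (t / 2))) powr (2 * d)
     * (q0 * cos (d * (pi - t) / 2) - q1 * sin (d * (pi - t) / 2))\<^sup>2) (at_right 0)"
    using eventually_at_right_real[of 0 "2 * pi", simplified]
  proof eventually_elim
    case (elim t)
    then have "0 < sin (t / 2)" by (intro sin_gt_zero) auto
    then show ?case using elim
      by (simp add: transfer_eq power_mult_distrib powr_divide powr_minus powr_power field_simps)
  qed
  then show ?thesis using tendsto_mult[OF 1 2] by (simp add: tendsto_cong)
qed

text \<open>The condition on \<open>q0\<close> and \<open>q1\<close> cancels the leading
  coefficient. What is left of the trigonometric factor is a multiple of
  \<open>sin (d * t / 2)\<close>, of order \<open>t\<close>, which outweighs the modulus of order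
  \<open>t powr (- d)\<close>.\<close>

lemma transfer_tendsto_0:
  assumes d: "0 < d" "d < 1/2" and q: "q0 * cos (d * pi / 2) = q1 * sin (d * pi / 2)"
  shows "(transfer d q0 q1 \<longlongrightarrow> 0) (at_right 0)"
proof -
  let ?\<kappa> = "q0 * sin (d * pi / 2) + q1 * cos (d * pi / 2)"
  have 1: "((\<lambda>t::real. ?\<kappa> * ((2 * sin (t / 2)) powr (- d) * sin (d * t / 2))) \<longlongrightarrow> ?\<kappa> * 0) (at_right 0)"
  proof (intro tendsto_intros)
    show "((\<lambda>t::real. (2 * sin (t / 2)) powr (- d) * sin (d * t / 2)) \<longlongrightarrow> 0) (at_right 0)"
      using d by real_asymp
  qed
  have "q0 * cos (d * (pi - t) / 2) - q1 * sin (d * (pi - t) / 2) = ?\<kappa> * sin (d * t / 2)" for t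
  proof -
    have "d * (pi - t) / 2 = d * pi / 2 - d * t / 2" by (simp add: field_simps)
    moreover have "q0 * (cos (d * pi / 2) * x + sin (d * pi / 2) * y)
        - q1 * (sin (d * pi / 2) * x - cos (d * pi / 2) * y) = ?\<kappa> * y" for x y
      using q by algebra
    ultimately show ?thesis by (simp only: cos_diff sin_diff)
  qed
  then have "eventually (\<lambda>t. transfer d q0 q1 t = ?\<kappa> * ((2 * sin (t / 2)) powr (- d) * sin (d * t / 2))) (at_right 0)"
    by (intro eventually_mono[OF eventually_at_right_real[of 0 "2 * pi"]]) (auto simp: transfer_eq)
  then show ?thesis using 1 by (simp add: tendsto_cong)
qed

lemma isCont_transfer:
  assumes "cis \<theta> \<noteq> 1"
  shows "isCont (transfer d q0 q1) \<theta>"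
proof -
  have "Re (1 - cis \<theta>) > 0"
    using assms cos_le_one[of \<theta>] by (auto simp: complex_eq_iff less_le) (metis cos_one_sin_zero)
  then have "1 - cis \<theta> \<notin> \<real>\<^sub>\<le>\<^sub>0" by (auto simp: complex_nonpos_Reals_iff)
  then show ?thesis
    unfolding transfer_def isCont_def by (intro tendsto_intros disjI1)
qed

section \<open>Fourier coefficients of the spectral density\<close>

text \<open>A restricted measure, so that the mean-square lemmas proved for an arbitrary
  \<open>M\<close> apply to functions of the frequency.\<close>

abbreviation period :: "real measure" where
  "period \<equiv> restrict_space lborel {-pi..pi}"

lemma integrable_period:
  fixes f :: "real \<Rightarrow> 'b::{banach, second_countable_topology}"
  assumes "continuous_on UNIV f"
  shows "integrable period f"
  using borel_integrable_atLeastAtMost'[OF continuous_on_subset[OF assms]]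
  by (simp add: integrable_restrict_space set_integrable_def)

section \<open>Orthogonality of sines and cosines over one period\<close>

lemma integral_period_derivative:
  fixes f F :: "real \<Rightarrow> real"
  assumes "\<And>x. (F has_field_derivative f x) (at x)" "continuous_on UNIV f"
  shows "(LINT x|period. f x) = F pi - F (- pi)"
proof -
  have "(LINT x|period. f x) = (LINT x|lborel. indicator {-pi..pi} x *\<^sub>R f x)"
    by (simp add: integral_restrict_space)
  also have "\<dots> = F pi - F (- pi)"
    using assms by (intro integral_FTC_atLeastAtMost continuous_on_subset[OF assms(2)])
      (auto simp: has_real_derivative_iff_has_vector_derivative intro: has_vector_derivative_at_within)
  finally show ?thesis .
qed

lemma integral_period_cos: "(LINT x|period. cos (of_int n * x)) = 2 * pi * of_bool (n = 0)"
proof (cases "n = 0")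
  case True
  then show ?thesis using integral_period_derivative[of "\<lambda>x. x" "\<lambda>x. 1"] by simp
next
  case False
  have "(LINT x|period. cos (of_int n * x)) = sin (of_int n * pi) / of_int n - sin (of_int n * - pi) / of_int n"
    by (rule integral_period_derivative)
      (use False in \<open>auto intro!: derivative_eq_intros continuous_intros\<close>)
  moreover have "sin (of_int n * pi) = 0" by (auto simp: sin_zero_iff_int2)
  ultimately show ?thesis using False by simp
qed

lemma integral_period_sin: "(LINT x|period. sin (of_int n * x)) = 0"
proof (cases "n = 0")
  case False
  have "(LINT x|period. sin (of_int n * x)) = - cos (of_int n * pi) / of_int n - - cos (of_int n * - pi) / of_int n"
    by (rule integral_period_derivative)
      (use False in \<open>auto intro!: derivative_eq_intros continuous_intros\<close>)
  then show ?thesis by simp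
qed simp

lemma integral_period_cos_cos:
  "(LINT x|period. cos (of_int h * x) * cos (of_int m * x)) = pi * (of_bool (m = h) + of_bool (m = - h))"
proof -
  have "(LINT x|period. cos (of_int h * x) * cos (of_int m * x))
      = (LINT x|period. (cos (of_int (h - m) * x) + cos (of_int (h + m) * x)) / 2)"
    by (intro Bochner_Integration.integral_cong refl) (simp add: cos_times_cos algebra_simps)
  also have "\<dots> = ((LINT x|period. cos (of_int (h - m) * x)) + (LINT x|period. cos (of_int (h + m) * x))) / 2"
    by (subst integral_divide_zero, subst Bochner_Integration.integral_add)
      (auto intro!: integrable_period continuous_intros)
  also have "\<dots> = pi * (of_bool (m = h) + of_bool (m = - h))"
    unfolding integral_period_cos by (auto simp: algebra_simps of_bool_def)
  finally show ?thesis .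
qed

lemma integral_period_sin_cos:
  "(LINT x|period. sin (of_int h * x) * cos (of_int m * x)) = 0"
proof -
  have "(LINT x|period. sin (of_int h * x) * cos (of_int m * x))
      = (LINT x|period. (sin (of_int (h + m) * x) + sin (of_int (h - m) * x)) / 2)"
    by (intro Bochner_Integration.integral_cong refl) (simp add: sin_add sin_diff distrib_right left_diff_distrib)
  also have "\<dots> = ((LINT x|period. sin (of_int (h + m) * x)) + (LINT x|period. sin (of_int (h - m) * x))) / 2"
    by (subst integral_divide_zero, subst Bochner_Integration.integral_add)
      (auto intro!: integrable_period continuous_intros)
  finally show ?thesis unfolding integral_period_sin by simp
qed

text \<open>The weights are arbitrary so that a difference of two partial sums is again of this
  form, with the early weights set to 0.\<close>

definition trig_sum :: "real \<Rightarrow> real \<Rightarrow> (nat \<Rightarrow> real) \<Rightarrow> nat \<Rightarrow> real \<Rightarrow> real" where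
  "trig_sum q0 q1 c N \<theta> = (\<Sum>k<N. c k * (q0 * cos (real k * \<theta>) - q1 * sin (real k * \<theta>)))"

lemma continuous_on_trig_sum [continuous_intros]:
  fixes f :: "real \<Rightarrow> real"
  shows "continuous_on A f \<Longrightarrow> continuous_on A (\<lambda>x. trig_sum q0 q1 c N (f x))"
  unfolding trig_sum_def by (auto intro!: continuous_intros)

text \<open>Products of two terms split into sum and difference frequencies; adding the values at
  \<open>l0 + x\<close> and \<open>l0 - x\<close> cancels what is odd in \<open>x\<close> and leaves
  only cosines.\<close>

lemma trig_sum_squares:
  "2 * (trig_sum q0 q1 c N (l0 + x))\<^sup>2 + 2 * (trig_sum q0 q1 c N (l0 - x))\<^sup>2
   = (\<Sum>k<N. \<Sum>l<N. c k * c l *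
        (2 * phase q0 q1 (real (k + l) * l0) * cos (of_int (int k + int l) * x)
         + 2 * (q0\<^sup>2 + q1\<^sup>2) * cos ((real k - real l) * l0) * cos (of_int (int k - int l) * x)))"
proof -
  let ?g = "\<lambda>k \<theta>. q0 * cos (real k * \<theta>) - q1 * sin (real k * \<theta>)"
  have pair: "2 * (?g k \<theta> * ?g l \<theta>)
      = phase q0 q1 (real (k + l) * \<theta>) + (q0\<^sup>2 + q1\<^sup>2) * cos ((real k - real l) * \<theta>)" for k l \<theta>
    by (simp add: phase_def distrib_right left_diff_distrib cos_add sin_add cos_diff)
      (simp add: power2_eq_square algebra_simps)
  have ph: "phase q0 q1 (a * (l0 + x)) + phase q0 q1 (a * (l0 - x)) = 2 * phase q0 q1 (a * l0) * cos (a * x)" for a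
    by (simp add: phase_def distrib_left right_diff_distrib cos_add sin_add cos_diff sin_diff)
      (simp add: algebra_simps)
  have co: "cos (a * (l0 + x)) + cos (a * (l0 - x)) = 2 * cos (a * l0) * cos (a * x)" for a
    by (simp add: distrib_left right_diff_distrib cos_add cos_diff)
  have sq: "2 * (trig_sum q0 q1 c N \<theta>)\<^sup>2 = (\<Sum>k<N. \<Sum>l<N. c k * c l * (2 * (?g k \<theta> * ?g l \<theta>)))" for \<theta>
  proof -
    have "2 * (trig_sum q0 q1 c N \<theta>)\<^sup>2 = 2 * (\<Sum>k<N. \<Sum>l<N. (c k * ?g k \<theta>) * (c l * ?g l \<theta>))"
      unfolding trig_sum_def power2_eq_square by (subst sum_product) (rule refl)
    also have "\<dots> = (\<Sum>k<N. \<Sum>l<N. c k * c l * (2 * (?g k \<theta> * ?g l \<theta>)))"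
      unfolding sum_distrib_left by (intro sum.cong refl) (simp only: mult_ac)
    finally show ?thesis .
  qed
  show ?thesis
    unfolding sq pair sum.distrib[symmetric]
  proof (intro sum.cong refl)
    fix k l
    have "c k * c l * (phase q0 q1 (real (k + l) * (l0 + x)) + (q0\<^sup>2 + q1\<^sup>2) * cos ((real k - real l) * (l0 + x)))
      + c k * c l * (phase q0 q1 (real (k + l) * (l0 - x)) + (q0\<^sup>2 + q1\<^sup>2) * cos ((real k - real l) * (l0 - x)))
      = c k * c l * ((phase q0 q1 (real (k + l) * (l0 + x)) + phase q0 q1 (real (k + l) * (l0 - x)))
         + (q0\<^sup>2 + q1\<^sup>2) * (cos ((real k - real l) * (l0 + x)) + cos ((real k - real l) * (l0 - x))))"
      by (simp add: algebra_simps)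
    then show "c k * c l * (phase q0 q1 (real (k + l) * (l0 + x)) + (q0\<^sup>2 + q1\<^sup>2) * cos ((real k - real l) * (l0 + x)))
      + c k * c l * (phase q0 q1 (real (k + l) * (l0 - x)) + (q0\<^sup>2 + q1\<^sup>2) * cos ((real k - real l) * (l0 - x)))
      = c k * c l * (2 * phase q0 q1 (real (k + l) * l0) * cos (of_int (int k + int l) * x)
         + 2 * (q0\<^sup>2 + q1\<^sup>2) * cos ((real k - real l) * l0) * cos (of_int (int k - int l) * x))"
      unfolding ph co by simp
  qed
qed

text \<open>The weight enters only through its cosine integrals, so one calculation yields both the
  cosine and the sine coefficients.\<close>

lemma integral_trig_sum_squares:
  fixes w :: "real \<Rightarrow> real"
  assumes w: "continuous_on UNIV w" "\<And>m. (LINT x|period. w x * cos (of_int m * x)) = pi * W m"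
  shows "(LINT x|period. w x * (2 * (trig_sum q0 q1 c N (l0 + x))\<^sup>2 + 2 * (trig_sum q0 q1 c N (l0 - x))\<^sup>2))
    = 2 * pi * (\<Sum>k<N. \<Sum>l<N. c k * c l * (phase q0 q1 (real (k + l) * l0) * W (int k + int l)
        + (q0\<^sup>2 + q1\<^sup>2) * cos ((real k - real l) * l0) * W (int k - int l)))"
proof -
  have i: "integrable period (\<lambda>x. w x * cos (of_int m * x))" for m
    by (intro integrable_period continuous_intros w)
  have "(LINT x|period. w x * (2 * (trig_sum q0 q1 c N (l0 + x))\<^sup>2 + 2 * (trig_sum q0 q1 c N (l0 - x))\<^sup>2))
    = (LINT x|period. (\<Sum>k<N. \<Sum>l<N.
        (c k * c l * 2 * phase q0 q1 (real (k + l) * l0)) * (w x * cos (of_int (int k + int l) * x))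
         + (c k * c l * 2 * (q0\<^sup>2 + q1\<^sup>2) * cos ((real k - real l) * l0)) * (w x * cos (of_int (int k - int l) * x))))"
    unfolding trig_sum_squares sum_distrib_left
    by (intro Bochner_Integration.integral_cong sum.cong refl) (simp only: algebra_simps)
  also have "\<dots> = (\<Sum>k<N. \<Sum>l<N.
        (c k * c l * 2 * phase q0 q1 (real (k + l) * l0)) * (pi * W (int k + int l))
         + (c k * c l * 2 * (q0\<^sup>2 + q1\<^sup>2) * cos ((real k - real l) * l0)) * (pi * W (int k - int l)))"
    using i by (simp add: w(2) Bochner_Integration.integral_sum Bochner_Integration.integral_add del: of_int_add of_int_diff)
  also have "\<dots> = 2 * pi * (\<Sum>k<N. \<Sum>l<N. c k * c l * (phase q0 q1 (real (k + l) * l0) * W (int k + int l)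
        + (q0\<^sup>2 + q1\<^sup>2) * cos ((real k - real l) * l0) * W (int k - int l)))"
    unfolding sum_distrib_left by (intro sum.cong refl) (simp only: algebra_simps)
  finally show ?thesis .
qed

lemma borel_measurable_transfer [measurable]:
  assumes "0 < d" "d < 1/2"
  shows "transfer d q0 q1 \<in> borel_measurable borel"
proof (rule borel_measurable_LIMSEQ_real)
  \<comment> \<open>At the singular points \<open>transfer\<close> is 0, because \<open>0 powr a = 0\<close>.\<close>
  let ?s = "\<lambda>N \<theta>. if cis \<theta> = 1 then 0 else trig_sum q0 q1 (frac_coeff d) N \<theta>"
  show "(\<lambda>N. ?s N \<theta>) \<longlonglongrightarrow> transfer d q0 q1 \<theta>" for \<theta>
  proof (cases "cis \<theta> = 1")
    case True
    then show ?thesis by (simp add: transfer_def)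
  next
    case False
    then show ?thesis
      using transfer_sums[of d \<theta> q0 q1] assms by (simp add: sums_def trig_sum_def)
  qed
  show "?s N \<in> borel_measurable borel" for N
  proof (rule measurable_If)
    show "trig_sum q0 q1 (frac_coeff d) N \<in> borel_measurable borel"
      using continuous_on_trig_sum[OF continuous_on_id] by (intro borel_measurable_continuous_onI) simp
    have "closed {\<theta>. cis \<theta> = 1}" by (intro closed_Collect_eq continuous_intros)
    then show "{x \<in> space borel. cis x = 1} \<in> sets borel" by auto
  qed auto
qed

section \<open>Location of the singularities within a period\<close>

lemma cis_eq_1_iff_0:
  assumes "\<bar>x\<bar> < 2 * pi"
  shows "cis x = 1 \<longleftrightarrow> x = 0"
proof
  assume "cis x = 1"
  then have "cos x = 1" by (simp add: complex_eq_iff)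
  then obtain n where "x = of_int n * 2 * pi" using cos_one_2pi_int by blast
  with assms have "\<bar>of_int n\<bar> * (2 * pi) < 1 * (2 * pi)" by (simp add: abs_mult mult.assoc)
  then have "\<bar>real_of_int n\<bar> < 1" by (simp only: mult_less_cancel_right) (use pi_gt_zero in auto)
  then show "x = 0" using \<open>x = of_int n * 2 * pi\<close> by simp
qed simp

text \<open>Both shifts lie strictly between \<open>- 2 * pi\<close> and \<open>2 * pi\<close>,
  where 0 is the only multiple of \<open>2 * pi\<close>.\<close>

lemma cis_shift_neq_1:
  assumes "l0 \<in> {0<..<pi}" "x \<in> {-pi..pi}" "x \<notin> {l0, -l0}"
  shows "cis (l0 + x) \<noteq> 1" "cis (l0 - x) \<noteq> 1"
  using assms by (subst cis_eq_1_iff_0; auto)+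

lemma AE_period_shift:
  assumes "l0 \<in> {0<..<pi}"
  shows "AE x in period. cis (l0 + x) \<noteq> 1 \<and> cis (l0 - x) \<noteq> 1"
proof -
  have "AE x in lborel. x \<noteq> l0 \<and> x \<noteq> - l0"
    using AE_lborel_singleton[of l0] AE_lborel_singleton[of "- l0"] by eventually_elim auto
  then have "AE x in lborel. x \<in> {-pi..pi} \<longrightarrow> cis (l0 + x) \<noteq> 1 \<and> cis (l0 - x) \<noteq> 1"
    by eventually_elim (use cis_shift_neq_1[OF assms] in auto)
  then show ?thesis by (subst AE_restrict_space_iff) auto
qed

lemma square_integrable_trig_sum:
  "square_integrable period (\<lambda>x. trig_sum q0 q1 c N (l0 + x))"
  "square_integrable period (\<lambda>x. trig_sum q0 q1 c N (l0 - x))"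
  unfolding square_integrable_def
  by (auto intro!: integrable_period continuous_intros borel_measurable_integrable)

text \<open>Time and frequency domain meet here: by \<open>integral_frmod_term_mult\<close> the same
  double sum is the covariance at lag \<open>h\<close> of the series truncated at
  \<open>N\<close>.\<close>

lemma integral_trig_sum_squares_cos:
  "(LINT x|period. cos (of_int h * x) * (2 * (trig_sum q0 q1 c N (l0 + x))\<^sup>2 + 2 * (trig_sum q0 q1 c N (l0 - x))\<^sup>2))
    = 2 * pi * (\<Sum>k<N. \<Sum>l<N. c k * c l * cov_kernel l0 q0 q1 h k l)"
  unfolding cov_kernel_def
  by (rule integral_trig_sum_squares) (auto intro!: continuous_intros simp: integral_period_cos_cos simp del: of_int_add of_int_diff)

lemma integral_trig_sum_squares_sin:
  "(LINT x|period. sin (of_int h * x) * (2 * (trig_sum q0 q1 c N (l0 + x))\<^sup>2 + 2 * (trig_sum q0 q1 c N (l0 - x))\<^sup>2)) = 0"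
  by (rule trans[OF integral_trig_sum_squares[where W = "\<lambda>m. 0"]])
    (auto intro!: continuous_intros simp: integral_period_sin_cos)

lemma trig_sum_diff:
  assumes "m \<le> n"
  shows "trig_sum q0 q1 c n \<theta> - trig_sum q0 q1 c m \<theta> = trig_sum q0 q1 (\<lambda>k. if m \<le> k then c k else 0) n \<theta>"
proof -
  have "trig_sum q0 q1 c n \<theta> - trig_sum q0 q1 c m \<theta>
      = (\<Sum>k=m..<n. c k * (q0 * cos (real k * \<theta>) - q1 * sin (real k * \<theta>)))"
    using assms unfolding trig_sum_def by (simp add: lessThan_atLeast0 sum_diff_nat_ivl)
  also have "\<dots> = trig_sum q0 q1 (\<lambda>k. if m \<le> k then c k else 0) n \<theta>"
    unfolding trig_sum_def by (intro sum.mono_neutral_cong_left) auto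
  finally show ?thesis .
qed

text \<open>Parseval's identity for a block of the series, read off from the cosine formula at lag
  0. Starting at \<open>m > 0\<close> removes the pair \<open>k = l = 0\<close>, the only one that
  meets the antidiagonal part of the kernel at lag 0.\<close>

lemma integral_trig_sum_diff:
  assumes mn: "0 < m" "m \<le> n"
  shows "(LINT x|period. (trig_sum q0 q1 c n (l0 + x) - trig_sum q0 q1 c m (l0 + x))\<^sup>2)
         + (LINT x|period. (trig_sum q0 q1 c n (l0 - x) - trig_sum q0 q1 c m (l0 - x))\<^sup>2)
       = 2 * pi * (q0\<^sup>2 + q1\<^sup>2) * (\<Sum>k=m..<n. (c k)\<^sup>2)"
proof -
  define b where "b k = (if m \<le> k then c k else 0)" for k
  note sq = square_integrable_trig_sum[of q0 q1 b n l0, unfolded square_integrable_def]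
  have "2 * ((LINT x|period. (trig_sum q0 q1 b n (l0 + x))\<^sup>2) + (LINT x|period. (trig_sum q0 q1 b n (l0 - x))\<^sup>2))
     = (LINT x|period. 2 * (trig_sum q0 q1 b n (l0 + x))\<^sup>2 + 2 * (trig_sum q0 q1 b n (l0 - x))\<^sup>2)"
    using sq by simp
  also have "\<dots> = 2 * pi * (\<Sum>k<n. \<Sum>l<n. b k * b l * cov_kernel l0 q0 q1 0 k l)"
    using integral_trig_sum_squares_cos[of 0] by simp
  also have "(\<Sum>k<n. \<Sum>l<n. b k * b l * cov_kernel l0 q0 q1 0 k l)
     = (\<Sum>k<n. \<Sum>l<n. if l = k then 2 * (q0\<^sup>2 + q1\<^sup>2) * (b k)\<^sup>2 else 0)"
    using mn(1) by (intro sum.cong refl) (auto simp: cov_kernel_def b_def power2_eq_square)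
  also have "\<dots> = (\<Sum>k<n. 2 * (q0\<^sup>2 + q1\<^sup>2) * (b k)\<^sup>2)"
    by (intro sum.cong refl) (auto simp: sum.delta)
  also have "\<dots> = (\<Sum>k=m..<n. 2 * (q0\<^sup>2 + q1\<^sup>2) * (c k)\<^sup>2)"
    by (intro sum.mono_neutral_cong_right) (auto simp: b_def)
  finally show ?thesis
    unfolding trig_sum_diff[OF mn(2)] b_def[symmetric] sum_distrib_left[symmetric] by (simp add: algebra_simps)
qed

text \<open>Parseval and the square summability of the coefficients make the partial sums Cauchy;
  pointwise convergence off the singularities identifies the limit.\<close>

lemma trig_sum_L2_tendsto:
  assumes d: "0 < d" "d < 1/2" and l0: "l0 \<in> {0<..<pi}"
  shows "square_integrable period (\<lambda>x. transfer d q0 q1 (l0 + x))" (is ?A)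
    "square_integrable period (\<lambda>x. transfer d q0 q1 (l0 - x))" (is ?B)
    "(\<lambda>N. LINT x|period. (trig_sum q0 q1 (frac_coeff d) N (l0 + x) - transfer d q0 q1 (l0 + x))\<^sup>2) \<longlonglongrightarrow> 0" (is ?C)
    "(\<lambda>N. LINT x|period. (trig_sum q0 q1 (frac_coeff d) N (l0 - x) - transfer d q0 q1 (l0 - x))\<^sup>2) \<longlonglongrightarrow> 0" (is ?D)
proof -
  let ?c = "frac_coeff d"
  let ?I = "\<lambda>m n. (LINT x|period. (trig_sum q0 q1 ?c m (l0 + x) - trig_sum q0 q1 ?c n (l0 + x))\<^sup>2)"
  let ?J = "\<lambda>m n. (LINT x|period. (trig_sum q0 q1 ?c m (l0 - x) - trig_sum q0 q1 ?c n (l0 - x))\<^sup>2)"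
  note [measurable] = borel_measurable_transfer[OF d]
  have conv: "(\<lambda>N. trig_sum q0 q1 ?c N \<theta>) \<longlonglongrightarrow> transfer d q0 q1 \<theta>" if "cis \<theta> \<noteq> 1" for \<theta>
    using transfer_sums[of d \<theta> q0 q1] d that by (simp add: sums_def trig_sum_def)
  have Cauchy: "\<exists>N. \<forall>m\<ge>N. \<forall>n\<ge>N. ?I m n \<le> e \<and> ?J m n \<le> e" if "e > 0" for e
  proof -
    \<comment> \<open>The added 1 keeps \<open>K\<close> positive also when \<open>q0\<close> and
      \<open>q1\<close> are both 0.\<close>
    define K where "K = 2 * pi * (q0\<^sup>2 + q1\<^sup>2) + 1"
    have K: "K > 0" by (simp add: K_def add_nonneg_pos)
    obtain N where N: "\<And>m n. m \<ge> N \<Longrightarrow> norm (\<Sum>k=m..<n. (?c k)\<^sup>2) < e / K"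
      using summable_frac_coeff_square[OF d] \<open>e > 0\<close> K unfolding summable_Cauchy
      by (meson divide_pos_pos)
    \<comment> \<open>The threshold \<open>N + 1\<close> makes the lower index positive, as
      \<open>integral_trig_sum_diff\<close> requires.\<close>
    have *: "?I m n \<le> e \<and> ?J m n \<le> e" if "m \<ge> N + 1" "n \<ge> N + 1" "n \<le> m" for m n
    proof -
      have "?I m n + ?J m n = 2 * pi * (q0\<^sup>2 + q1\<^sup>2) * (\<Sum>k=n..<m. (?c k)\<^sup>2)"
        using that by (intro integral_trig_sum_diff) auto
      also have "\<dots> \<le> K * (e / K)"
        using N[of n m] that by (intro mult_mono) (auto simp: K_def sum_nonneg)
      also have "\<dots> = e" using K by simp
      finally have "?I m n + ?J m n \<le> e" .
      moreover have "0 \<le> ?I m n" "0 \<le> ?J m n" by auto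
      ultimately show ?thesis by linarith
    qed
    show ?thesis
    proof (intro exI[of _ "N + 1"] allI impI)
      fix m n assume "m \<ge> N + 1" "n \<ge> N + 1"
      then show "?I m n \<le> e \<and> ?J m n \<le> e"
        using *[of m n] *[of n m] by (cases "n \<le> m") (auto simp: power2_commute)
    qed
  qed
  have m1: "(\<lambda>x. transfer d q0 q1 (l0 + x)) \<in> borel_measurable period"
    "(\<lambda>x. transfer d q0 q1 (l0 - x)) \<in> borel_measurable period"
    by (auto intro!: measurable_restrict_space1)
  have a: "AE x in period. (\<lambda>N. trig_sum q0 q1 ?c N (l0 + x)) \<longlonglongrightarrow> transfer d q0 q1 (l0 + x)"
    "AE x in period. (\<lambda>N. trig_sum q0 q1 ?c N (l0 - x)) \<longlonglongrightarrow> transfer d q0 q1 (l0 - x)"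
    using AE_period_shift[OF l0] by (eventually_elim; use conv in blast)+
  show ?A ?C
    using Cauchy by (intro L2_Cauchy_pointwise_limit[OF square_integrable_trig_sum(1) m1(1) a(1)]; meson)+
  show ?B ?D
    using Cauchy by (intro L2_Cauchy_pointwise_limit[OF square_integrable_trig_sum(2) m1(2) a(2)]; meson)+
qed

text \<open>This is \<open>2 * pi\<close> times the spectral density of one component; modulation by
  a real carrier shifts the squared transfer function by \<open>l0\<close> in both
  directions.\<close>

definition frmod_power :: "real \<Rightarrow> real \<Rightarrow> real \<Rightarrow> real \<Rightarrow> real \<Rightarrow> real" where
  "frmod_power l0 d q0 q1 l = 2 * (transfer d q0 q1 (l0 + l))\<^sup>2 + 2 * (transfer d q0 q1 (l0 - l))\<^sup>2"

lemma integrable_frmod_power: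
  assumes "0 < d" "d < 1/2" "l0 \<in> {0<..<pi}"
  shows "integrable period (frmod_power l0 d q0 q1)"
  using trig_sum_L2_tendsto(1,2)[OF assms, of q0 q1]
  by (simp add: square_integrable_def frmod_power_def[abs_def])

text \<open>A bounded weight preserves mean-square convergence. Grouping each weighted square as
  \<open>(w x * f x) * f x\<close> brings the integral into the form of
  \<open>L2_tendsto_integral_mult\<close>.\<close>

lemma integral_bounded_frmod_power_tendsto:
  fixes w :: "real \<Rightarrow> real"
  assumes d: "0 < d" "d < 1/2" and l0: "l0 \<in> {0<..<pi}"
    and w: "continuous_on UNIV w" "\<And>x. \<bar>w x\<bar> \<le> 1"
  shows "(\<lambda>N. LINT x|period. w x * (2 * (trig_sum q0 q1 (frac_coeff d) N (l0 + x))\<^sup>2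
      + 2 * (trig_sum q0 q1 (frac_coeff d) N (l0 - x))\<^sup>2))
     \<longlonglongrightarrow> (LINT x|period. w x * frmod_power l0 d q0 q1 x)"
proof -
  have wm: "w \<in> borel_measurable period"
    by (intro borel_measurable_integrable integrable_period w)
  have w1: "(w x)\<^sup>2 \<le> 1" for x using w(2)[of x] by (simp add: abs_square_le_1)
  have sw: "square_integrable period (\<lambda>x. w x * f x)" if "square_integrable period f" for f :: "real \<Rightarrow> real"
    unfolding square_integrable_def
  proof
    have [measurable]: "f \<in> borel_measurable period" using that by (simp add: square_integrable_def)
    note wm [measurable]
    show "(\<lambda>x. w x * f x) \<in> borel_measurable period" by measurable
    show "integrable period (\<lambda>x. (norm (w x * f x))\<^sup>2)"
    proof (rule Bochner_Integration.integrable_bound)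
      show "integrable period (\<lambda>x. (norm (f x))\<^sup>2)" using that by (simp add: square_integrable_def)
      have "(w x)\<^sup>2 * (f x)\<^sup>2 \<le> 1 * (f x)\<^sup>2" for x by (intro mult_right_mono w1) auto
      then show "AE x in period. norm ((norm (w x * f x))\<^sup>2) \<le> norm ((norm (f x))\<^sup>2)"
        by (simp add: power_mult_distrib abs_mult)
    qed measurable
  qed
  have main: "(\<lambda>N. LINT x|period. (w x * U N x) * U N x) \<longlonglongrightarrow> (LINT x|period. (w x * u x) * u x)"
    if U: "\<And>N. square_integrable period (U N)" and u: "square_integrable period u"
      and lim: "(\<lambda>N. LINT x|period. (U N x - u x)\<^sup>2) \<longlonglongrightarrow> 0" for U and u :: "real \<Rightarrow> real"
  proof (rule L2_tendsto_integral_mult[OF sw[OF U] sw[OF u] _ U u lim])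
    show "(\<lambda>N. LINT x|period. (w x * U N x - w x * u x)\<^sup>2) \<longlonglongrightarrow> 0"
    proof (rule Lim_null_comparison[OF always_eventually[OF allI] lim])
      fix N
      have "(LINT x|period. (w x * U N x - w x * u x)\<^sup>2) \<le> (LINT x|period. (U N x - u x)\<^sup>2)"
      proof (rule integral_mono)
        show "integrable period (\<lambda>x. (w x * U N x - w x * u x)\<^sup>2)"
          using square_integrable_diff[OF sw[OF U] sw[OF u]] by (simp add: square_integrable_def)
        show "integrable period (\<lambda>x. (U N x - u x)\<^sup>2)"
          using square_integrable_diff[OF U u] by (simp add: square_integrable_def)
        show "(w x * U N x - w x * u x)\<^sup>2 \<le> (U N x - u x)\<^sup>2" for x
          using mult_right_mono[OF w1[of x], of "(U N x - u x)\<^sup>2"]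
          by (simp add: power_mult_distrib flip: right_diff_distrib)
      qed
      then show "norm (LINT x|period. (w x * U N x - w x * u x)\<^sup>2) \<le> (LINT x|period. (U N x - u x)\<^sup>2)"
        by simp
    qed
  qed
  note L = trig_sum_L2_tendsto[OF d l0, of q0 q1]
  note S = square_integrable_trig_sum[of q0 q1 "frac_coeff d" _ l0]
  have split: "(LINT x|period. w x * (2 * (f x)\<^sup>2 + 2 * (g x)\<^sup>2))
      = 2 * (LINT x|period. (w x * f x) * f x) + 2 * (LINT x|period. (w x * g x) * g x)"
    if "square_integrable period f" "square_integrable period g" for f g :: "real \<Rightarrow> real"
  proof -
    have "(LINT x|period. w x * (2 * (f x)\<^sup>2 + 2 * (g x)\<^sup>2))
        = (LINT x|period. 2 * ((w x * f x) * f x) + 2 * ((w x * g x) * g x))"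
      by (intro Bochner_Integration.integral_cong refl) (simp add: power2_eq_square algebra_simps)
    also have "\<dots> = 2 * (LINT x|period. (w x * f x) * f x) + 2 * (LINT x|period. (w x * g x) * g x)"
      using square_integrable_mult_integrable[OF sw[OF that(1)] that(1)]
        square_integrable_mult_integrable[OF sw[OF that(2)] that(2)]
      by (subst Bochner_Integration.integral_add) auto
    finally show ?thesis .
  qed
  show ?thesis
    unfolding frmod_power_def split[OF S] split[OF L(1,2)]
    by (intro tendsto_intros main S L)
qed

text \<open>The cosine integrals of the truncated densities converge both to the integral of
  \<open>frmod_power\<close>, by mean-square convergence, and to the explicit autocovariance, by the
  double sum. The truncated sine integrals all vanish.\<close>

lemma frmod_power_Fourier:
  assumes d: "0 < d" "d < 1/2" and l0: "l0 \<in> {0<..<pi}"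
  shows "(LINT x|period. cos (of_int h * x) * frmod_power l0 d q0 q1 x) = 2 * pi * frmod_acv l0 d q0 q1 (nat \<bar>h\<bar>)"
    and "(LINT x|period. sin (of_int h * x) * frmod_power l0 d q0 q1 x) = 0"
proof -
  have "(\<lambda>N. LINT x|period. cos (of_int h * x) * (2 * (trig_sum q0 q1 (frac_coeff d) N (l0 + x))\<^sup>2
      + 2 * (trig_sum q0 q1 (frac_coeff d) N (l0 - x))\<^sup>2))
     \<longlonglongrightarrow> (LINT x|period. cos (of_int h * x) * frmod_power l0 d q0 q1 x)"
    by (intro integral_bounded_frmod_power_tendsto assms continuous_intros) auto
  moreover have "(\<lambda>N. LINT x|period. cos (of_int h * x) * (2 * (trig_sum q0 q1 (frac_coeff d) N (l0 + x))\<^sup>2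
      + 2 * (trig_sum q0 q1 (frac_coeff d) N (l0 - x))\<^sup>2))
     \<longlonglongrightarrow> 2 * pi * frmod_acv l0 d q0 q1 (nat \<bar>h\<bar>)"
    unfolding integral_trig_sum_squares_cos by (intro tendsto_intros cov_kernel_sum_tendsto d)
  ultimately show "(LINT x|period. cos (of_int h * x) * frmod_power l0 d q0 q1 x) = 2 * pi * frmod_acv l0 d q0 q1 (nat \<bar>h\<bar>)"
    by (rule LIMSEQ_unique)
  have "(\<lambda>N. LINT x|period. sin (of_int h * x) * (2 * (trig_sum q0 q1 (frac_coeff d) N (l0 + x))\<^sup>2
      + 2 * (trig_sum q0 q1 (frac_coeff d) N (l0 - x))\<^sup>2))
     \<longlonglongrightarrow> (LINT x|period. sin (of_int h * x) * frmod_power l0 d q0 q1 x)"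
    by (intro integral_bounded_frmod_power_tendsto assms continuous_intros) auto
  then show "(LINT x|period. sin (of_int h * x) * frmod_power l0 d q0 q1 x) = 0"
    unfolding integral_trig_sum_squares_sin by (simp add: LIMSEQ_const_iff)
qed

section \<open>Second moments of the FRMod series\<close>

lemma Q_plus_mult: "Q_plus q0 q1 *v v = vector [q0 * v $ 1 + q1 * v $ 2, - q1 * v $ 1 + q0 * v $ 2]"
  by (simp add: vec_eq_iff forall_2 matrix_vector_mult_def sum_2 Q_plus_def)

lemma Q_minus_mult: "Q_minus q0 q1 *v v = vector [q0 * v $ 1 - q1 * v $ 2, q1 * v $ 1 + q0 * v $ 2]"
  by (simp add: vec_eq_iff forall_2 matrix_vector_mult_def sum_2 Q_minus_def Q_plus_def transpose_def)

lemma inner_real2: "(v :: real^2) \<bullet> w = v $ 1 * w $ 1 + v $ 2 * w $ 2"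
  by (simp add: inner_vec_def sum_2)

section \<open>Moments of white noise projected to scalars\<close>

lemma white_noise_mean:
  assumes "prob_space M" "bivariate_white_noise M e"
  shows "(LINT w|M. v \<bullet> e n w) = 0"
proof -
  interpret prob_space M by fact
  have "integrable M (e n)"
    using assms(2) by (intro square_integrable_imp_integrable_norm) (simp add: bivariate_white_noise_def)
  then show ?thesis using assms(2) by (simp add: bivariate_white_noise_def)
qed

lemma white_noise_covariance:
  assumes e: "bivariate_white_noise M e"
  shows "(LINT w|M. (v \<bullet> e n w) * (v' \<bullet> e m w)) = (v \<bullet> v') * of_bool (n = m)"
proof -
  have sq: "square_integrable M (\<lambda>w. e n w $ i)" for n i
    using e square_integrable_inner[of M "e n" "axis i 1"]
    by (simp add: bivariate_white_noise_def inner_axis' )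
  have int: "integrable M (\<lambda>w. e n w $ i * e m w $ j)" for i j
    by (rule square_integrable_mult_integrable[OF sq sq])
  have E: "(LINT w|M. e n w $ i * e m w $ j) = of_bool (n = m \<and> i = j)" for i j
  proof -
    have "(\<chi> i j. LINT w|M. e n w $ i * e m w $ j) = (if n = m then mat 1 else 0)"
      using e by (simp add: bivariate_white_noise_def)
    then have "(\<chi> i j. LINT w|M. e n w $ i * e m w $ j) $ i $ j = (if n = m then mat 1 else 0 :: real^2^2) $ i $ j"
      by simp
    then show ?thesis by (simp add: mat_def)
  qed
  have "(LINT w|M. (v \<bullet> e n w) * (v' \<bullet> e m w))
     = (LINT w|M. v $ 1 * v' $ 1 * (e n w $ 1 * e m w $ 1) + v $ 1 * v' $ 2 * (e n w $ 1 * e m w $ 2)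
        + v $ 2 * v' $ 1 * (e n w $ 2 * e m w $ 1) + v $ 2 * v' $ 2 * (e n w $ 2 * e m w $ 2))"
    by (intro Bochner_Integration.integral_cong refl) (simp add: inner_real2 algebra_simps)
  also have "\<dots> = v $ 1 * v' $ 1 * of_bool (n = m) + v $ 2 * v' $ 2 * of_bool (n = m)"
    using int by (simp add: E)
  finally show ?thesis by (simp add: inner_real2 algebra_simps)
qed

definition carrier_vec :: "real \<Rightarrow> int \<Rightarrow> real^2" where
  "carrier_vec l0 n = vector [cos (l0 * of_int n), sin (l0 * of_int n)]"

text \<open>The matrix is moved off the noise by transposition, hence \<open>Q_minus\<close> for the
  past and \<open>Q_plus\<close> for the future.\<close>

definition past_vec :: "real \<Rightarrow> real \<Rightarrow> real \<Rightarrow> int \<Rightarrow> real^2" where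
  "past_vec l0 q0 q1 n = Q_minus q0 q1 *v carrier_vec l0 n"

definition future_vec :: "real \<Rightarrow> real \<Rightarrow> real \<Rightarrow> int \<Rightarrow> real^2" where
  "future_vec l0 q0 q1 n = Q_plus q0 q1 *v carrier_vec l0 n"

lemma norm_carrier_vec: "norm (carrier_vec l0 n) = 1"
  by (simp add: norm_eq_sqrt_inner inner_real2 carrier_vec_def flip: power2_eq_square)

lemma carrier_vec_inner_Q:
  "carrier_vec l0 n \<bullet> (Q_plus q0 q1 *v v) = past_vec l0 q0 q1 n \<bullet> v"
  "carrier_vec l0 n \<bullet> (Q_minus q0 q1 *v v) = future_vec l0 q0 q1 n \<bullet> v"
  by (simp_all add: past_vec_def future_vec_def Q_plus_mult Q_minus_mult inner_real2 algebra_simps)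

text \<open>Identify a vector of the plane with a complex number and put
  \<open>a = q0 + i q1\<close>. Then \<open>past_vec\<close> is \<open>a * cis (l0 * n)\<close>,
  \<open>future_vec\<close> is \<open>cnj a * cis (l0 * n)\<close>, and the inner product of
  \<open>u\<close> and \<open>v\<close> is \<open>Re (u * cnj v)\<close>.\<close>

lemma inner_past_future_vec:
  defines "a \<equiv> past_vec" and "b \<equiv> future_vec"
  shows "a l0 q0 q1 n \<bullet> a l0 q0 q1 m = (q0\<^sup>2 + q1\<^sup>2) * cos (l0 * of_int (n - m))"
    and "b l0 q0 q1 n \<bullet> b l0 q0 q1 m = (q0\<^sup>2 + q1\<^sup>2) * cos (l0 * of_int (n - m))"
    and "a l0 q0 q1 n \<bullet> b l0 q0 q1 m = phase q0 q1 (l0 * of_int (n - m))"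
    and "b l0 q0 q1 n \<bullet> a l0 q0 q1 m = phase q0 q1 (l0 * of_int (m - n))"
  unfolding a_def b_def
  by (simp_all add: past_vec_def future_vec_def Q_plus_mult Q_minus_mult carrier_vec_def inner_real2
      phase_def right_diff_distrib cos_diff sin_diff)
    (simp_all add: power2_eq_square algebra_simps)

text \<open>Past and future innovations at the same distance \<open>k\<close> are joined, so the
  truncated series is a single sum; at \<open>k = 0\<close> both parts contain
  \<open>e n\<close>.\<close>

definition frmod_term where
  "frmod_term l0 d q0 q1 (e :: int \<Rightarrow> 'w \<Rightarrow> real^2) n k w =
     frac_coeff d k * (past_vec l0 q0 q1 n \<bullet> e (n - int k) w + future_vec l0 q0 q1 n \<bullet> e (n + int k) w)"

lemma square_integrable_frmod_term:
  assumes "bivariate_white_noise M e"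
  shows "square_integrable M (frmod_term l0 d q0 q1 e n k)"
  unfolding frmod_term_def real_scaleR_def[symmetric] using assms
  by (intro square_integrable_scaleR square_integrable_add square_integrable_inner)
    (simp_all add: bivariate_white_noise_def)

text \<open>Of the four pairings of innovations each survives only when its two times agree. Then
  \<open>n - m\<close> equals \<open>k - l\<close> or \<open>k + l\<close> up to sign, so the inner
  products of the coefficient vectors become functions of \<open>k\<close> and
  \<open>l\<close>.\<close>

lemma integral_frmod_term_mult:
  assumes e: "bivariate_white_noise M e"
  shows "(LINT w|M. frmod_term l0 d q0 q1 e n k w * frmod_term l0 d q0 q1 e m l w)
     = frac_coeff d k * frac_coeff d l * cov_kernel l0 q0 q1 (n - m) k l"
proof -
  define a where "a = past_vec l0 q0 q1"
  define b where "b = future_vec l0 q0 q1"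
  have int: "integrable M (\<lambda>w. (v \<bullet> e p w) * (v' \<bullet> e q w))" for v v' p q
    using e by (intro square_integrable_mult_integrable square_integrable_inner)
      (simp_all add: bivariate_white_noise_def)
  have "(LINT w|M. frmod_term l0 d q0 q1 e n k w * frmod_term l0 d q0 q1 e m l w)
     = (LINT w|M. frac_coeff d k * frac_coeff d l *
        ((a n \<bullet> e (n - int k) w) * (a m \<bullet> e (m - int l) w) + (a n \<bullet> e (n - int k) w) * (b m \<bullet> e (m + int l) w)
         + (b n \<bullet> e (n + int k) w) * (a m \<bullet> e (m - int l) w) + (b n \<bullet> e (n + int k) w) * (b m \<bullet> e (m + int l) w)))"
    unfolding frmod_term_def a_def[symmetric] b_def[symmetric]
    by (intro Bochner_Integration.integral_cong refl) (simp add: algebra_simps)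
  also have "\<dots> = frac_coeff d k * frac_coeff d l *
     ((a n \<bullet> a m) * of_bool (n - int k = m - int l) + (a n \<bullet> b m) * of_bool (n - int k = m + int l)
      + (b n \<bullet> a m) * of_bool (n + int k = m - int l) + (b n \<bullet> b m) * of_bool (n + int k = m + int l))"
    using int by (simp add: white_noise_covariance[OF e])
  also have "(a n \<bullet> a m) * of_bool (n - int k = m - int l) + (a n \<bullet> b m) * of_bool (n - int k = m + int l)
      + (b n \<bullet> a m) * of_bool (n + int k = m - int l) + (b n \<bullet> b m) * of_bool (n + int k = m + int l)
      = cov_kernel l0 q0 q1 (n - m) k l"
  proof -
    have "(a n \<bullet> a m) * of_bool (n - int k = m - int l)
        = (q0\<^sup>2 + q1\<^sup>2) * cos ((real k - real l) * l0) * of_bool (int k - int l = n - m)"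
    proof (cases "int k - int l = n - m")
      case True
      then have "of_int (n - m) = real k - real l" by (metis of_int_diff of_int_of_nat_eq)
      with True show ?thesis by (simp add: a_def inner_past_future_vec mult.commute del: of_int_diff)
    qed auto
    moreover have "(b n \<bullet> b m) * of_bool (n + int k = m + int l)
        = (q0\<^sup>2 + q1\<^sup>2) * cos ((real k - real l) * l0) * of_bool (int k - int l = - (n - m))"
    proof (cases "int k - int l = - (n - m)")
      case True
      then have "of_int (n - m) = - (real k - real l)" by (metis of_int_diff of_int_minus of_int_of_nat_eq minus_minus)
      then have "cos (l0 * of_int (n - m)) = cos ((real k - real l) * l0)"
        by (metis cos_minus mult.commute mult_minus_right)
      with True show ?thesis by (simp add: b_def inner_past_future_vec del: of_int_diff)
    qed auto
    moreover have "(a n \<bullet> b m) * of_bool (n - int k = m + int l)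
        = phase q0 q1 (real (k + l) * l0) * of_bool (int k + int l = n - m)"
    proof (cases "int k + int l = n - m")
      case True
      then have "of_int (n - m) = real (k + l)" by (metis of_int_of_nat_eq of_nat_add)
      with True show ?thesis by (simp add: a_def b_def inner_past_future_vec mult.commute del: of_int_diff of_nat_add)
    qed auto
    moreover have "(b n \<bullet> a m) * of_bool (n + int k = m - int l)
        = phase q0 q1 (real (k + l) * l0) * of_bool (int k + int l = - (n - m))"
    proof (cases "int k + int l = - (n - m)")
      case True
      then have "m - n = int (k + l)" by simp
      then have "of_int (m - n) = real (k + l)" by (metis of_int_of_nat_eq)
      with True show ?thesis by (simp add: a_def b_def inner_past_future_vec mult.commute del: of_int_diff of_nat_add)
    qed auto
    ultimately show ?thesis unfolding cov_kernel_def by (simp add: algebra_simps)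
  qed
  finally show ?thesis .
qed

text \<open>Both vector sums are cut at the same \<open>N\<close> and projected on the carrier. As
  the carrier has norm 1, the projection does not enlarge errors, and
  \<open>(a + b)^2 \<le> 2 * a^2 + 2 * b^2\<close> separates the causal from the anticausal
  one.\<close>

lemma frmod_terms_mean_square:
  assumes e: "bivariate_white_noise M e"
    and A: "mean_square_sums M (\<lambda>k w. frac_coeff d k *\<^sub>R (Q_plus q0 q1 *v e (n - int k) w)) A"
    and B: "mean_square_sums M (\<lambda>k w. frac_coeff d k *\<^sub>R (Q_minus q0 q1 *v e (n + int k) w)) B"
  shows "square_integrable M (\<lambda>w. carrier_vec l0 n \<bullet> (A w + B w))"
    and "(\<lambda>N. LINT w|M. ((\<Sum>k<N. frmod_term l0 d q0 q1 e n k w) - carrier_vec l0 n \<bullet> (A w + B w))\<^sup>2) \<longlonglongrightarrow> 0"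
proof -
  let ?u = "carrier_vec l0 n"
  let ?A = "\<lambda>N w. (\<Sum>k<N. frac_coeff d k *\<^sub>R (Q_plus q0 q1 *v e (n - int k) w)) - A w"
  let ?B = "\<lambda>N w. (\<Sum>k<N. frac_coeff d k *\<^sub>R (Q_minus q0 q1 *v e (n + int k) w)) - B w"
  have sq: "square_integrable M (?A N)" "square_integrable M (?B N)" for N
    using A B unfolding mean_square_sums_def
    by (auto intro!: square_integrable_diff square_integrable_sum)
  show X: "square_integrable M (\<lambda>w. ?u \<bullet> (A w + B w))"
    using A B by (auto intro!: square_integrable_inner square_integrable_add simp: mean_square_sums_def)
  have "(\<lambda>N. 2 * (LINT w|M. (norm (?A N w))\<^sup>2) + 2 * (LINT w|M. (norm (?B N w))\<^sup>2)) \<longlonglongrightarrow> 2 * 0 + 2 * 0"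
    using A B unfolding mean_square_sums_def by (intro tendsto_intros) auto
  then have lim: "(\<lambda>N. 2 * (LINT w|M. (norm (?A N w))\<^sup>2) + 2 * (LINT w|M. (norm (?B N w))\<^sup>2)) \<longlonglongrightarrow> 0"
    by simp
  have T: "(\<Sum>k<N. frmod_term l0 d q0 q1 e n k w) - ?u \<bullet> (A w + B w) = ?u \<bullet> (?A N w + ?B N w)" for N w
    by (simp add: frmod_term_def carrier_vec_inner_Q inner_diff_right inner_add_right inner_sum_right
        sum.distrib distrib_left)
  have "norm (LINT w|M. ((\<Sum>k<N. frmod_term l0 d q0 q1 e n k w) - ?u \<bullet> (A w + B w))\<^sup>2)
      \<le> 2 * (LINT w|M. (norm (?A N w))\<^sup>2) + 2 * (LINT w|M. (norm (?B N w))\<^sup>2)" for N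
  proof -
    have i: "integrable M (\<lambda>w. (norm (?A N w))\<^sup>2)" "integrable M (\<lambda>w. (norm (?B N w))\<^sup>2)"
      using sq[of N] by (auto simp: square_integrable_def)
    have "(LINT w|M. (?u \<bullet> (?A N w + ?B N w))\<^sup>2)
        \<le> (LINT w|M. 2 * (norm (?A N w))\<^sup>2 + 2 * (norm (?B N w))\<^sup>2)"
    proof (rule integral_mono)
      show "integrable M (\<lambda>w. (?u \<bullet> (?A N w + ?B N w))\<^sup>2)"
        using square_integrable_inner[OF square_integrable_add[OF sq]] by (simp add: square_integrable_def)
      show "integrable M (\<lambda>w. 2 * (norm (?A N w))\<^sup>2 + 2 * (norm (?B N w))\<^sup>2)" using i by auto
      show "(?u \<bullet> (?A N w + ?B N w))\<^sup>2 \<le> 2 * (norm (?A N w))\<^sup>2 + 2 * (norm (?B N w))\<^sup>2" for w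
      proof -
        have "\<bar>?u \<bullet> (?A N w + ?B N w)\<bar> \<le> norm (?A N w) + norm (?B N w)"
          using Cauchy_Schwarz_ineq2[of ?u "?A N w + ?B N w"] norm_triangle_ineq[of "?A N w" "?B N w"]
          by (simp add: norm_carrier_vec)
        from power_mono[OF this abs_ge_zero, of 2]
        have "(?u \<bullet> (?A N w + ?B N w))\<^sup>2 \<le> (norm (?A N w) + norm (?B N w))\<^sup>2"
          by (simp only: power2_abs)
        also have "\<dots> \<le> 2 * (norm (?A N w))\<^sup>2 + 2 * (norm (?B N w))\<^sup>2"
          using sum_squares_bound[of "norm (?A N w)" "norm (?B N w)"] by (simp add: power2_sum)
        finally show ?thesis .
      qed
    qed
    also have "\<dots> = 2 * (LINT w|M. (norm (?A N w))\<^sup>2) + 2 * (LINT w|M. (norm (?B N w))\<^sup>2)"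
      using i by simp
    finally show ?thesis unfolding T by simp
  qed
  then show "(\<lambda>N. LINT w|M. ((\<Sum>k<N. frmod_term l0 d q0 q1 e n k w) - ?u \<bullet> (A w + B w))\<^sup>2) \<longlonglongrightarrow> 0"
    by (rule Lim_null_comparison[OF always_eventually[OF allI] lim])
qed

text \<open>First and second moments are finite sums for the truncated series and pass to its
  mean-square limit.\<close>

lemma FRMod0d0_moments:
  assumes M: "prob_space M" and d: "0 < d" "d < 1/2" and X: "FRMod0d0 M l0 d q0 q1 X"
  shows "square_integrable M (X n)"
    and "(LINT w|M. X n w) = 0"
    and "(LINT w|M. X n w * X m w) = frmod_acv l0 d q0 q1 (nat \<bar>n - m\<bar>)"
proof -
  interpret prob_space M by fact
  obtain e A B Y where e: "bivariate_white_noise M e"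
    and A: "\<And>n. mean_square_sums M (\<lambda>k w. frac_coeff d k *\<^sub>R (Q_plus q0 q1 *v e (n - int k) w)) (A n)"
    and B: "\<And>n. mean_square_sums M (\<lambda>k w. frac_coeff d k *\<^sub>R (Q_minus q0 q1 *v e (n + int k) w)) (B n)"
    and Y: "\<And>n w. Y n w = A n w + B n w"
    and XY: "\<And>n w. X n w = cos (l0 * of_int n) * Y n w $ 1 + sin (l0 * of_int n) * Y n w $ 2"
    using X unfolding FRMod0d0_def by blast
  have X_eq: "X n = (\<lambda>w. carrier_vec l0 n \<bullet> (A n w + B n w))" for n
    by (simp add: fun_eq_iff XY Y inner_real2 carrier_vec_def)
  note L = frmod_terms_mean_square[OF e A B, of l0, folded X_eq]
  show "square_integrable M (X n)" by (rule L)
  let ?t = "frmod_term l0 d q0 q1 e"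
  let ?T = "\<lambda>n N w. \<Sum>k<N. ?t n k w"
  have lim: "(\<lambda>N. LINT w|M. (?T n N w - X n w)\<^sup>2) \<longlonglongrightarrow> 0" for n
    using L(2)[of n] by (simp add: X_eq)
  have sT: "square_integrable M (?T n N)" for n N
    by (intro square_integrable_sum square_integrable_frmod_term e)
  have s1: "square_integrable M (\<lambda>w. 1::real)" by (simp add: square_integrable_def)
  \<comment> \<open>The mean is treated as a product moment with the constant 1, which is square
    integrable under a probability measure.\<close>
  have "(\<lambda>N. LINT w|M. ?T n N w * 1) \<longlonglongrightarrow> (LINT w|M. X n w * 1)"
    by (rule L2_tendsto_integral_mult[OF sT L(1) lim s1 s1]) simp
  moreover have "(LINT w|M. ?T n N w * 1) = 0" for N
  proof -
    have i: "integrable M (\<lambda>w. v \<bullet> e p w)" for v p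
      using e by (intro square_integrable_imp_integrable_norm square_integrable_inner)
        (simp add: bivariate_white_noise_def)
    have "(LINT w|M. ?t n k w) = 0" for k
      using i by (simp add: frmod_term_def white_noise_mean[OF M e])
    moreover have "integrable M (?t n k)" for k
      by (intro square_integrable_imp_integrable_norm square_integrable_frmod_term e)
    ultimately show ?thesis by (simp add: Bochner_Integration.integral_sum)
  qed
  ultimately show "(LINT w|M. X n w) = 0" by (simp add: LIMSEQ_const_iff)
  have "(\<lambda>N. LINT w|M. ?T n N w * ?T m N w) \<longlonglongrightarrow> (LINT w|M. X n w * X m w)"
    by (rule L2_tendsto_integral_mult[OF sT L(1) lim sT L(1) lim])
  moreover have "(LINT w|M. ?T n N w * ?T m N w)
      = (\<Sum>k<N. \<Sum>l<N. frac_coeff d k * frac_coeff d l * cov_kernel l0 q0 q1 (n - m) k l)" for N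
  proof -
    have "integrable M (\<lambda>w. ?t n k w * ?t m l w)" for k l
      by (intro square_integrable_mult_integrable square_integrable_frmod_term e)
    then show ?thesis
      by (simp add: sum_product Bochner_Integration.integral_sum integral_frmod_term_mult[OF e])
  qed
  ultimately have "(\<lambda>N. \<Sum>k<N. \<Sum>l<N. frac_coeff d k * frac_coeff d l * cov_kernel l0 q0 q1 (n - m) k l)
      \<longlonglongrightarrow> (LINT w|M. X n w * X m w)" by simp
  then show "(LINT w|M. X n w * X m w) = frmod_acv l0 d q0 q1 (nat \<bar>n - m\<bar>)"
    using cov_kernel_sum_tendsto[OF d] LIMSEQ_unique by blast
qed

section \<open>The spectral density of the sum\<close>

lemma integrable_period_bounded_mult:
  fixes w S :: "real \<Rightarrow> real"
  assumes w: "continuous_on UNIV w" "\<And>x. \<bar>w x\<bar> \<le> 1" and S: "integrable period S"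
  shows "integrable period (\<lambda>x. w x * S x)"
proof (rule Bochner_Integration.integrable_bound[OF S])
  have [measurable]: "w \<in> borel_measurable period"
    using w(1) by (intro borel_measurable_integrable integrable_period)
  have [measurable]: "S \<in> borel_measurable period" using S by simp
  show "(\<lambda>x. w x * S x) \<in> borel_measurable period" by measurable
  show "AE x in period. norm (w x * S x) \<le> norm (S x)"
    using w(2) by (simp add: abs_mult mult_left_le_one_le)
qed

text \<open>At the points of \<open>X\<close> the value of \<open>spectral_density\<close> may be
  unspecified. A finite set is null, so every integral may be computed with \<open>S\<close>
  instead, split into its real cosine and sine parts.\<close>

lemma has_spectral_densityI:
  assumes X: "finite X"
    and conv: "\<And>l. l \<in> {-pi..pi} - X \<Longrightarrow> spectral_partial_sum \<gamma> l \<longlonglongrightarrow> of_real (S l)"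
    and S: "integrable period S"
    and cos: "\<And>h. (LINT x|period. cos (of_int h * x) * S x) = 2 * pi * \<gamma> h"
    and sin: "\<And>h. (LINT x|period. sin (of_int h * x) * S x) = 0"
  shows "has_spectral_density \<gamma>"
    and "\<And>l. l \<in> {-pi..pi} - X \<Longrightarrow> spectral_density \<gamma> l = S l / (2 * pi)"
proof -
  show sd: "spectral_density \<gamma> l = S l / (2 * pi)" if "l \<in> {-pi..pi} - X" for l
    using limI[OF conv[OF that]] by (simp add: spectral_density_def)
  note Sbd = integrable_period_bounded_mult[OF _ _ S]
  show "has_spectral_density \<gamma>"
    unfolding has_spectral_density_def
  proof (intro conjI allI)
    have "AE l in lborel. \<forall>x\<in>X. l \<noteq> x"
      using X by (intro AE_finite_allI AE_lborel_singleton)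
    then show "AE l in lborel. l \<in> {-pi..pi} \<longrightarrow> convergent (spectral_partial_sum \<gamma> l)"
      by eventually_elim (use conv in \<open>blast intro: convergentI\<close>)
    have "integrable lborel (\<lambda>x. indicator {-pi..pi} x *\<^sub>R (S x / (2 * pi)))"
      using S by (simp add: integrable_restrict_space)
    also have "?this \<longleftrightarrow> integrable lborel (\<lambda>x. indicator {-pi..pi} x *\<^sub>R spectral_density \<gamma> x)"
      using X sd by (intro integrable_discrete_difference[where X = X])
        (auto simp: countable_finite indicator_def)
    finally show "set_integrable lborel {-pi..pi} (spectral_density \<gamma>)"
      by (simp add: set_integrable_def)
    fix h
    have "(LINT l:{-pi..pi}|lborel. cis (of_int h * l) * complex_of_real (spectral_density \<gamma> l))
      = (LINT l|lborel. indicator {-pi..pi} l *\<^sub>R (cis (of_int h * l) * complex_of_real (S l / (2 * pi))))"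
      unfolding set_lebesgue_integral_def
      using X sd by (intro integral_discrete_difference[where X = X])
        (auto simp: countable_finite indicator_def)
    also have "\<dots> = (LINT l|period. cis (of_int h * l) * complex_of_real (S l / (2 * pi)))"
      by (rule integral_restrict_space[symmetric]) simp
    also have "\<dots> = (LINT l|period. complex_of_real (cos (of_int h * l) * S l) / complex_of_real (2 * pi)
        + \<i> * (complex_of_real (sin (of_int h * l) * S l) / complex_of_real (2 * pi)))"
      by (intro Bochner_Integration.integral_cong refl) (auto simp: complex_eq_iff)
    also have "\<dots> = (LINT l|period. complex_of_real (cos (of_int h * l) * S l)) / complex_of_real (2 * pi)
        + \<i> * ((LINT l|period. complex_of_real (sin (of_int h * l) * S l)) / complex_of_real (2 * pi))"
    proof -
      have "integrable period (\<lambda>l. complex_of_real (cos (of_int h * l) * S l))"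
        "integrable period (\<lambda>l. complex_of_real (sin (of_int h * l) * S l))"
        by (intro integrable_of_real Sbd continuous_intros; simp)+
      then show ?thesis
        by (subst Bochner_Integration.integral_add) (simp_all del: of_real_mult)
    qed
    also have "\<dots> = complex_of_real (\<gamma> h)"
      unfolding integral_complex_of_real cos sin by simp
    finally show "complex_of_real (\<gamma> h) = (LINT l:{-pi..pi}|lborel.
        cis (of_int h * l) * complex_of_real (spectral_density \<gamma> l))" ..
  qed
qed

text \<open>The sign \<open>s\<close> selects the side of \<open>l0\<close>. One summand is
  evaluated near the regular point \<open>2 * l0\<close>, the other at the singular origin, where
  \<open>transfer_minus\<close> brings the argument to \<open>t\<close>.\<close>

lemma frmod_power_near_l0:
  assumes "s \<in> {1, -1}"
  shows "frmod_power l0 d q0 q1 (l0 + s * t)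
     = 2 * (transfer d q0 q1 (2 * l0 + s * t))\<^sup>2 + 2 * (transfer d q0 (- s * q1) t)\<^sup>2"
  using assms by (auto simp: frmod_power_def transfer_minus)

lemma transfer_2l0_tendsto:
  assumes "l0 \<in> {0<..<pi}"
  shows "((\<lambda>t. transfer d q0 q1 (2 * l0 + s * t)) \<longlongrightarrow> transfer d q0 q1 (2 * l0)) (at_right 0)"
proof (rule isCont_tendsto_compose[OF isCont_transfer])
  show "cis (2 * l0) \<noteq> 1" using assms by (subst cis_eq_1_iff_0) auto
  have "((\<lambda>t. 2 * l0 + s * t) \<longlongrightarrow> 2 * l0 + s * 0) (at_right 0)" by (intro tendsto_intros)
  then show "((\<lambda>t. 2 * l0 + s * t) \<longlongrightarrow> 2 * l0) (at_right 0)" by simp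
qed

lemma powr_tendsto_0_at_right:
  "0 < a \<Longrightarrow> ((\<lambda>t::real. t powr a) \<longlongrightarrow> 0) (at_right 0)"
  by real_asymp

text \<open>Rescaling sends the regular summand to 0, so the limit comes from the singular one
  alone.\<close>

lemma frmod_power_scaled_tendsto:
  assumes d: "0 < d" and l0: "l0 \<in> {0<..<pi}" and s: "s \<in> {1, -1}"
  shows "((\<lambda>t. t powr (2 * d) * frmod_power l0 d q0 q1 (l0 + s * t))
     \<longlongrightarrow> 2 * (q0 * cos (d * pi / 2) + s * q1 * sin (d * pi / 2))\<^sup>2) (at_right 0)"
proof -
  have "((\<lambda>t. 2 * (t powr (2 * d) * (transfer d q0 q1 (2 * l0 + s * t))\<^sup>2)
       + 2 * (t powr (2 * d) * (transfer d q0 (- s * q1) t)\<^sup>2))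
     \<longlongrightarrow> 2 * (0 * (transfer d q0 q1 (2 * l0))\<^sup>2) + 2 * (q0 * cos (d * pi / 2) - (- s * q1) * sin (d * pi / 2))\<^sup>2)
     (at_right 0)"
    by (intro tendsto_add tendsto_mult[OF tendsto_const] tendsto_mult[OF powr_tendsto_0_at_right]
        tendsto_power transfer_2l0_tendsto transfer_scaled_tendsto l0) (use d in simp)
  then show ?thesis unfolding frmod_power_near_l0[OF s] by (simp add: algebra_simps)
qed

text \<open>On the side where the leading coefficient vanishes the singular summand tends to 0, so
  this component stays bounded near \<open>l0\<close>.\<close>

lemma frmod_power_tendsto:
  assumes d: "0 < d" "d < 1/2" and l0: "l0 \<in> {0<..<pi}" and s: "s \<in> {1, -1}"
    and q: "q0 * cos (d * pi / 2) + s * q1 * sin (d * pi / 2) = 0"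
  shows "((\<lambda>t. frmod_power l0 d q0 q1 (l0 + s * t)) \<longlongrightarrow> 2 * (transfer d q0 q1 (2 * l0))\<^sup>2) (at_right 0)"
proof -
  have "(transfer d q0 (- s * q1) \<longlongrightarrow> 0) (at_right 0)"
    using q by (intro transfer_tendsto_0 d) (simp add: algebra_simps)
  then have "((\<lambda>t. 2 * (transfer d q0 q1 (2 * l0 + s * t))\<^sup>2 + 2 * (transfer d q0 (- s * q1) t)\<^sup>2)
     \<longlongrightarrow> 2 * (transfer d q0 q1 (2 * l0))\<^sup>2 + 2 * 0\<^sup>2) (at_right 0)"
    by (intro tendsto_intros transfer_2l0_tendsto l0)
  then show ?thesis unfolding frmod_power_near_l0[OF s] by simp
qed

text \<open>The first component is singular on the chosen side and the second is bounded there, so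
  rescaling by \<open>t powr (2 * d)\<close> removes the second.\<close>

lemma two_frmod_power_asymp_equiv:
  fixes f :: "real \<Rightarrow> real"
  assumes d: "0 < d" "0 < d'" "d' < 1/2" and l0: "l0 \<in> {0<..<pi}" and s: "s \<in> {1, -1}"
    and q': "q0' * cos (d' * pi / 2) + s * q1' * sin (d' * pi / 2) = 0"
    and c: "c = (q0 * cos (d * pi / 2) + s * q1 * sin (d * pi / 2))\<^sup>2 / pi" "c \<noteq> 0"
    and f: "\<And>l. l \<in> {-pi..pi} - {l0, -l0} \<Longrightarrow>
        f l = (frmod_power l0 d q0 q1 l + frmod_power l0 d' q0' q1' l) / (2 * pi)"
  shows "(\<lambda>t. f (l0 + s * t)) \<sim>[at_right 0] (\<lambda>t. c * t powr (- 2 * d))"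
proof (rule asymp_equivI')
  let ?g = "\<lambda>t. (t powr (2 * d) * frmod_power l0 d q0 q1 (l0 + s * t)
      + t powr (2 * d) * frmod_power l0 d' q0' q1' (l0 + s * t)) / (2 * pi * c)"
  have lim: "(?g \<longlongrightarrow> (2 * (q0 * cos (d * pi / 2) + s * q1 * sin (d * pi / 2))\<^sup>2
      + 0 * (2 * (transfer d' q0' q1' (2 * l0))\<^sup>2)) / (2 * pi * c)) (at_right 0)"
    by (intro tendsto_divide tendsto_add frmod_power_scaled_tendsto frmod_power_tendsto
        tendsto_mult[OF powr_tendsto_0_at_right] tendsto_const d l0 s q') (use d c in simp_all)
  have one: "(2 * (q0 * cos (d * pi / 2) + s * q1 * sin (d * pi / 2))\<^sup>2
      + 0 * (2 * (transfer d' q0' q1' (2 * l0))\<^sup>2)) / (2 * pi * c) = 1"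
    using c(2) unfolding c(1) by simp
  have ev: "eventually (\<lambda>t. f (l0 + s * t) / (c * t powr (- 2 * d)) = ?g t) (at_right 0)"
  proof (rule eventually_mono)
    \<comment> \<open>For such \<open>t\<close> both \<open>l0 + t\<close> and \<open>l0 - t\<close>
      stay between 0 and \<open>pi\<close>, away from the two excluded points.\<close>
    show "eventually (\<lambda>t. t \<in> {0<..<min l0 (pi - l0)}) (at_right 0)"
      using l0 by (intro eventually_at_right_real) auto
    fix t assume t: "t \<in> {0<..<min l0 (pi - l0)}"
    then have "l0 + s * t \<in> {-pi..pi} - {l0, -l0}" using s l0 by auto
    show "f (l0 + s * t) / (c * t powr (- 2 * d)) = ?g t"
      unfolding f[OF \<open>l0 + s * t \<in> _\<close>] distrib_left[symmetric]
      using t c(2) by (simp add: powr_minus divide_simps)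
  qed
  show "((\<lambda>t. f (l0 + s * t) / (c * t powr (- 2 * d))) \<longlongrightarrow> 1) (at_right 0)"
    by (subst tendsto_cong[OF ev]) (rule lim[unfolded one])
qed

lemma at_left_eq_filtermap_minus: "at_left (a::real) = filtermap (\<lambda>t. a - t) (at_right 0)"
proof -
  have "at_left a = filtermap uminus (filtermap (\<lambda>x. x + - a) (at_right 0))"
    by (subst at_left_minus, subst at_right_to_0) (rule refl)
  then show ?thesis by (simp add: filtermap_filtermap)
qed

text \<open>With \<open>x = d * pi / 2\<close> the quotient in front of \<open>q\<close> is
  \<open>tan x\<close>. Hence the two terms of the leading coefficient cancel on one side of
  \<open>l0\<close> and add up to modulus \<open>2 * abs q * sin x\<close> on the other;
  \<open>1 - cos (4 * x)\<close> equals 8 times the squares of \<open>sin x\<close> and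
  \<open>cos x\<close>, which yields the constant.\<close>

lemma half_angle_parameters:
  fixes d q :: real
  assumes "d \<in> {0<..<1/2}"
  shows "sin (pi * d) / (1 + cos (pi * d)) * q * cos (d * pi / 2) = q * sin (d * pi / 2)"
    and "q\<^sup>2 * (1 - cos (2 * pi * d)) / (pi * (1 + cos (pi * d))) = (2 * q * sin (d * pi / 2))\<^sup>2 / pi"
    and "0 < sin (d * pi / 2)"
proof -
  define x where "x = d * pi / 2"
  have x: "pi * d = 2 * x" "2 * pi * d = 2 * (2 * x)" by (simp_all add: x_def)
  have "0 < x" "x < pi / 2" using assms by (auto simp: x_def)
  then have s: "0 < sin x" and c: "0 < cos x" by (auto intro: sin_gt_zero cos_gt_zero)
  have "1 + cos (2 * x) = 2 * (cos x)\<^sup>2" by (simp add: cos_double_cos)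
  note e = this sin_double[of x]
  show "sin (pi * d) / (1 + cos (pi * d)) * q * cos (d * pi / 2) = q * sin (d * pi / 2)"
    unfolding x x_def[symmetric] e using c by (simp add: power2_eq_square)
  have "1 - cos (2 * (2 * x)) = 2 * (2 * sin x * cos x)\<^sup>2"
    unfolding cos_double_sin[of "2 * x"] sin_double by simp
  then show "q\<^sup>2 * (1 - cos (2 * pi * d)) / (pi * (1 + cos (pi * d))) = (2 * q * sin (d * pi / 2))\<^sup>2 / pi"
    unfolding x x_def[symmetric] e using c by (simp add: power_mult_distrib)
  show "0 < sin (d * pi / 2)" using s by (simp add: x_def)
qed

theorem mainTheorem8:
  fixes M :: "'w measure"
    and l0 dp dm q0p q0m q1p q1m cp cm :: real
    and Xp Xm X :: "int \<Rightarrow> 'w \<Rightarrow> real"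
    and f :: "real \<Rightarrow> real"
  assumes "prob_space M"
    and "l0 \<in> {0<..<pi}"
    and "dp \<in> {0<..<1/2}" and "dm \<in> {0<..<1/2}" and "dp \<noteq> dm"
    and "q1p \<noteq> 0" and "q1m \<noteq> 0"
    and "q0p = sin (pi * dp) / (1 + cos (pi * dp)) * q1p"
    and "q0m = - (sin (pi * dm) / (1 + cos (pi * dm)) * q1m)"
    and "FRMod0d0 M l0 dp q0p q1p Xp"
    and "FRMod0d0 M l0 dm q0m q1m Xm"
    and "uncorrelated_series M Xp Xm"
    and "X = (\<lambda>n w. Xp n w + Xm n w)"
    and "f = spectral_density (autocovariance M X)"
    and "cp = q1p\<^sup>2 * (1 - cos (2 * pi * dp)) / (pi * (1 + cos (pi * dp)))"
    and "cm = q1m\<^sup>2 * (1 - cos (2 * pi * dm)) / (pi * (1 + cos (pi * dm)))"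
  shows "second_order_stationary M X \<and>
    has_spectral_density (autocovariance M X) \<and>
    f \<sim>[at_right l0] (\<lambda>l. cp * (l - l0) powr (- 2 * dp)) \<and>
    f \<sim>[at_left l0] (\<lambda>l. cm * (l0 - l) powr (- 2 * dm))"
proof -
  note dp = assms(3) and dm = assms(4) and l0 = assms(2)
  have dp': "0 < dp" "dp < 1/2" and dm': "0 < dm" "dm < 1/2" using dp dm by auto
  interpret prob_space M by fact
  note P = FRMod0d0_moments[OF assms(1) dp' assms(10)]
  note N = FRMod0d0_moments[OF assms(1) dm' assms(11)]
  have X: "X n = (\<lambda>w. Xp n w + Xm n w)" for n using assms(13) by simp
  have sq: "square_integrable M (X n)" for n unfolding X by (intro square_integrable_add P N)
  have mean: "(LINT w|M. X n w) = 0" for n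
    unfolding X using square_integrable_imp_integrable_norm[OF P(1)] square_integrable_imp_integrable_norm[OF N(1)]
    by (simp add: P N)
  let ?\<gamma> = "\<lambda>h. frmod_acv l0 dp q0p q1p (nat \<bar>h\<bar>) + frmod_acv l0 dm q0m q1m (nat \<bar>h\<bar>)"
  have cov: "covariance M (X n) (X m) = ?\<gamma> (n - m)" for n m
  proof -
    \<comment> \<open>Both series have mean zero, so being uncorrelated means orthogonality in mean
      square.\<close>
    have cross: "(LINT w|M. Xp i w * Xm j w) = 0" for i j
      using assms(12) by (simp add: uncorrelated_series_def covariance_def P N)
    have int: "integrable M (\<lambda>w. Xp i w * Xp j w)" "integrable M (\<lambda>w. Xp i w * Xm j w)"
      "integrable M (\<lambda>w. Xm i w * Xm j w)" for i j
      by (intro square_integrable_mult_integrable P N)+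
    have "covariance M (X n) (X m) = (LINT w|M. X n w * X m w)"
      by (simp add: covariance_def mean)
    also have "\<dots> = (LINT w|M. Xp n w * Xp m w + Xp n w * Xm m w + Xp m w * Xm n w + Xm n w * Xm m w)"
      unfolding X by (intro Bochner_Integration.integral_cong refl) (simp add: algebra_simps)
    also have "\<dots> = ?\<gamma> (n - m)" using int by (simp add: cross P N)
    finally show ?thesis .
  qed
  have \<gamma>: "autocovariance M X = ?\<gamma>" by (simp add: fun_eq_iff autocovariance_def cov)
  have stat: "second_order_stationary M X"
    unfolding second_order_stationary_def by (simp add: sq mean cov)
  let ?S = "\<lambda>l. frmod_power l0 dp q0p q1p l + frmod_power l0 dm q0m q1m l"
  have conv: "spectral_partial_sum (autocovariance M X) l \<longlonglongrightarrow> of_real (?S l)"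
    if "l \<in> {-pi..pi} - {l0, -l0}" for l
  proof -
    have "cis (l0 + l) \<noteq> 1" "cis (l0 - l) \<noteq> 1" using cis_shift_neq_1[OF l0, of l] that by auto
    note c = this
    have "(\<lambda>n. spectral_partial_sum (\<lambda>h. frmod_acv l0 dp q0p q1p (nat \<bar>h\<bar>)) l n
        + spectral_partial_sum (\<lambda>h. frmod_acv l0 dm q0m q1m (nat \<bar>h\<bar>)) l n)
       \<longlonglongrightarrow> of_real (frmod_power l0 dp q0p q1p l) + of_real (frmod_power l0 dm q0m q1m l)"
      unfolding frmod_power_def
      by (intro tendsto_add spectral_partial_sum_frmod[OF dp' _ c] spectral_partial_sum_frmod[OF dm' _ c]) simp_all
    then show ?thesis
      by (simp add: \<gamma> spectral_partial_sum_def[abs_def] distrib_left sum.distrib)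
  qed
  have Sint: "integrable period ?S"
    by (intro Bochner_Integration.integrable_add integrable_frmod_power dp' dm' l0)
  have "integrable period (\<lambda>x. cos (of_int h * x) * frmod_power l0 d q0 q1 x)"
    "integrable period (\<lambda>x. sin (of_int h * x) * frmod_power l0 d q0 q1 x)"
    if "0 < d" "d < 1/2" for d q0 q1 h
    by (intro integrable_period_bounded_mult integrable_frmod_power that l0 continuous_intros; simp)+
  then have Fourier: "(LINT x|period. cos (of_int h * x) * ?S x) = 2 * pi * autocovariance M X h"
    "(LINT x|period. sin (of_int h * x) * ?S x) = 0" for h
    using dp' dm' l0 by (simp_all add: \<gamma> distrib_left frmod_power_Fourier)
  note spec = has_spectral_densityI[where X = "{l0, -l0}", OF _ conv Sint Fourier]
  have f: "f l = ?S l / (2 * pi)" if "l \<in> {-pi..pi} - {l0, -l0}" for l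
    unfolding assms(14) by (rule spec(2)) (use that in auto)
  note hp = half_angle_parameters[OF dp] and hm = half_angle_parameters[OF dm]
  have q0p: "q0p * cos (dp * pi / 2) = q1p * sin (dp * pi / 2)"
    using hp(1)[of q1p] by (simp add: assms(8))
  have q0m: "q0m * cos (dm * pi / 2) = - q1m * sin (dm * pi / 2)"
    using hm(1)[of q1m] by (simp add: assms(9))
  \<comment> \<open>To the right of \<open>l0\<close> the choice of \<open>q0m\<close> keeps the
    density of \<open>Xm\<close> bounded, while that of \<open>Xp\<close> is singular with leading
    coefficient \<open>2 * q1p * sin (dp * pi / 2)\<close>.\<close>
  have "(\<lambda>t. f (l0 + 1 * t)) \<sim>[at_right 0] (\<lambda>t. cp * t powr (- 2 * dp))"
  proof (rule two_frmod_power_asymp_equiv[OF dp'(1) dm' l0])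
    show "cp = (q0p * cos (dp * pi / 2) + 1 * q1p * sin (dp * pi / 2))\<^sup>2 / pi"
      unfolding assms(15) hp(2) q0p by (simp add: power_mult_distrib)
    show "cp \<noteq> 0" unfolding assms(15) hp(2) using hp(3) assms(6) by simp
  qed (use f q0m in simp_all)
  then have "(\<lambda>t. f (t + l0)) \<sim>[at_right 0] (\<lambda>t. cp * ((t + l0) - l0) powr (- 2 * dp))"
    by (simp only: mult_1 add.commute[of l0] add_diff_cancel_right')
  then have right: "f \<sim>[at_right l0] (\<lambda>l. cp * (l - l0) powr (- 2 * dp))"
    unfolding at_right_to_0[of l0] asymp_equiv_def filterlim_filtermap .
  \<comment> \<open>To the left the roles are exchanged: \<open>s = -1\<close> reverses the sign of
    the \<open>q1\<close> terms, so the contributions of \<open>Xp\<close> now cancel and those of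
    \<open>Xm\<close> add up.\<close>
  have "(\<lambda>t. f (l0 + (-1) * t)) \<sim>[at_right 0] (\<lambda>t. cm * t powr (- 2 * dm))"
  proof (rule two_frmod_power_asymp_equiv[OF dm'(1) dp' l0])
    show "cm = (q0m * cos (dm * pi / 2) + (-1) * q1m * sin (dm * pi / 2))\<^sup>2 / pi"
      unfolding assms(16) hm(2) q0m by (simp add: power2_eq_square)
    show "cm \<noteq> 0" unfolding assms(16) hm(2) using hm(3) assms(7) by simp
  qed (use f q0p in \<open>simp_all add: add.commute\<close>)
  then have "(\<lambda>t. f (l0 - t)) \<sim>[at_right 0] (\<lambda>t. cm * (l0 - (l0 - t)) powr (- 2 * dm))"
    by simp
  then have left: "f \<sim>[at_left l0] (\<lambda>l. cm * (l0 - l) powr (- 2 * dm))"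
    unfolding at_left_eq_filtermap_minus asymp_equiv_def filterlim_filtermap .
  show ?thesis using stat spec(1) right left by auto
qed

end
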